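(* There exist universal positive constants $c_0,c_4,c_6,c_7$ such that the following holds. Let $\varepsilon\in(0,1)$, let $\bm{a}_1,\dots,\bm{a}_N\in\mathbb{C}^D$ be i.i.d. uniform on the sphere $\{\bm{x}\in\mathbb{C}^D:\|\bm{x}\|_2=\sqrt{D}\}$ and independent of $\bm{H},\bm{Z}$. Let $\bm{\gamma}^{\natural}\in\mathbb{R}^N_+$ have support $S^{\natural}$ with $|S^{\natural}|=K$, let $\bm{Y}=\bm{A}\,\mathrm{diag}(\bm{\gamma}^{\natural})^{1/2}\bm{H}+\bm{Z}$, $\widehat{\bm{\Sigma}}_y=\frac1M\bm{Y}\bm{Y}^*$, and for $k\in[N]$ let $\mathcal{Y}_k=\sum_{1\le i,j\le D}\overline{a}_{k,i}a_{k,j}\widehat{\Sigma}_y(i,j)$. Let $S^0=\{k\in[N]:\mathcal{Y}_k>\overline{\mathcal{Y}}\}$ where $\overline{\mathcal{Y}}=\frac1N\sum_{k=1}^N\mathcal{Y}_k$. Write $\gamma^{\natural}_{\min},\gamma^{\natural}_{\max}$ for the smallest and largest entries of $\bm{\gamma}^{\natural}$ on $S^{\natural}$ and $c_\gamma=\gamma^{\natural}_{\max}/\gamma^{\natural}_{\min}$. If $$M\ge c_4\left(c_\gamma K+\frac{\sigma^2}{\gamma^{\natural}_{\min}}\right)^2\log\left(\frac{(eD)^2}{\varepsilon}\right)\quad\text{and}\quad K\le\min\left\{\frac{c_6D}{c_\gamma\log(DN)},\frac{c_7N}{c_\gamma}\right\},$$ then $\mathbb{P}(S^{\natural}\subset 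S^0)\ge1-\varepsilon-\frac{c_0}{D\sqrt{D}}$.
   Context: Model: $\bm{A}=[\bm{a}_1,\dots,\bm{a}_N]\in\mathbb{C}^{D\times N}$, $a_{k,i}$ is the $i$-th entry of $\bm{a}_k$; $\bm{H}\in\mathbb{C}^{N\times M}$ has i.i.d. $\mathcal{CN}(0,1)$ entries, $\bm{Z}\in\mathbb{C}^{D\times M}$ has i.i.d. $\mathcal{CN}(0,\sigma^2)$ entries, $\bm{H},\bm{Z}$ independent; $\widehat{\Sigma}_y(i,j)$ is the $(i,j)$ entry of $\widehat{\bm{\Sigma}}_y$; $\overline{a}$ denotes complex conjugate. *)

theory Defs
  imports "HOL-Probability.Probability"
begin

definition std_cnormal :: "complex measure" where
  "std_cnormal = density lborel (\<lambda>z. ennreal (exp (- ((cmod z)^2)) / pi))"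

definition cnormal :: "real \<Rightarrow> complex measure" where
  "cnormal v = distr std_cnormal borel (\<lambda>z. complex_of_real (sqrt v) * z)"

definition cvec_space :: "nat \<Rightarrow> (nat \<Rightarrow> complex) measure" where
  "cvec_space D = PiM {..<D} (\<lambda>_. lborel)"

definition cvec_norm :: "nat \<Rightarrow> (nat \<Rightarrow> complex) \<Rightarrow> real" where
  "cvec_norm D x = sqrt (\<Sum>i<D. (cmod (x i))^2)"

definition unif_cball :: "nat \<Rightarrow> (nat \<Rightarrow> complex) measure" where
  "unif_cball D = uniform_measure (cvec_space D) {x \<in> space (cvec_space D). cvec_norm D x \<le> 1}"

text \<open>Uniform (normalized surface = cone) measure on the sphere of radius r in C^D:
  radial projection of the uniform measure on the unit ball.\<close>
definition unif_csphere :: "nat \<Rightarrow> real \<Rightarrow> (nat \<Rightarrow> complex) measure" where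
  "unif_csphere D r = distr (unif_cball D) (cvec_space D)
     (\<lambda>x. restrict (\<lambda>i. complex_of_real (r / cvec_norm D x) * x i) {..<D})"

text \<open>Joint law of (A, H, Z): a_1..a_N i.i.d. uniform on sphere of radius sqrt D (A k i = a_{k,i}),
  H (k,m) i.i.d. CN(0,1), Z (i,m) i.i.d. CN(0,sigma^2), all independent.\<close>
definition data_law :: "nat \<Rightarrow> nat \<Rightarrow> nat \<Rightarrow> real \<Rightarrow>
    ((nat \<Rightarrow> nat \<Rightarrow> complex) \<times> (nat \<times> nat \<Rightarrow> complex) \<times> (nat \<times> nat \<Rightarrow> complex)) measure" where
  "data_law D N M \<sigma> =
     (PiM {..<N} (\<lambda>_. unif_csphere D (sqrt (real D))))
     \<Otimes>\<^sub>M ((PiM ({..<N} \<times> {..<M}) (\<lambda>_. cnormal 1))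
     \<Otimes>\<^sub>M (PiM ({..<D} \<times> {..<M}) (\<lambda>_. cnormal (\<sigma>^2))))"

definition Ymat :: "nat \<Rightarrow> (nat \<Rightarrow> real) \<Rightarrow> (nat \<Rightarrow> nat \<Rightarrow> complex) \<Rightarrow> (nat \<times> nat \<Rightarrow> complex)
    \<Rightarrow> (nat \<times> nat \<Rightarrow> complex) \<Rightarrow> nat \<Rightarrow> nat \<Rightarrow> complex" where
  "Ymat N \<gamma> A H Z i m = (\<Sum>k<N. A k i * complex_of_real (sqrt (\<gamma> k)) * H (k, m)) + Z (i, m)"

definition Sigma_hat :: "nat \<Rightarrow> (nat \<Rightarrow> nat \<Rightarrow> complex) \<Rightarrow> nat \<Rightarrow> nat \<Rightarrow> complex" where
  "Sigma_hat M Y i j = (1 / of_nat M) * (\<Sum>m<M. Y i m * cnj (Y j m))"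

definition Ystat :: "nat \<Rightarrow> (nat \<Rightarrow> complex) \<Rightarrow> (nat \<Rightarrow> nat \<Rightarrow> complex) \<Rightarrow> complex" where
  "Ystat D a S = (\<Sum>i<D. \<Sum>j<D. cnj (a i) * a j * S i j)"

text \<open>S^0 = {k in [N]. Y_k > mean}; the Y_k are real (Hermitian quadratic forms), compared via Re.\<close>
definition S0_set :: "nat \<Rightarrow> nat \<Rightarrow> nat \<Rightarrow> (nat \<Rightarrow> real) \<Rightarrow> (nat \<Rightarrow> nat \<Rightarrow> complex)
    \<Rightarrow> (nat \<times> nat \<Rightarrow> complex) \<Rightarrow> (nat \<times> nat \<Rightarrow> complex) \<Rightarrow> nat set" where
  "S0_set D N M \<gamma> A H Z =
    (let Sig = Sigma_hat M (Ymat N \<gamma> A H Z);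
         Yk = (\<lambda>k. Re (Ystat D (A k) Sig))
     in {k. k < N \<and> Yk k > (1 / real N) * (\<Sum>l<N. Yk l)})"

definition gamma_supp :: "nat \<Rightarrow> (nat \<Rightarrow> real) \<Rightarrow> nat set" where
  "gamma_supp N \<gamma> = {k. k < N \<and> \<gamma> k \<noteq> 0}"

definition gamma_min :: "nat \<Rightarrow> (nat \<Rightarrow> real) \<Rightarrow> real" where
  "gamma_min N \<gamma> = Min (\<gamma> ` gamma_supp N \<gamma>)"

definition gamma_max :: "nat \<Rightarrow> (nat \<Rightarrow> real) \<Rightarrow> real" where
  "gamma_max N \<gamma> = Max (\<gamma> ` gamma_supp N \<gamma>)"

end

theory Submission
  imports Defs
begin

text \<open>
  Given the columns \<open>a\<^sub>k\<close>, the inner products \<open>\<langle>a\<^sub>k, y\<^sub>m\<rangle>\<close> are i.i.d. in \<open>m\<close> with law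
  CN(0, \<open>v\<^sub>k\<close>), where \<open>v\<^sub>k\<close> is the sum of \<open>\<gamma>\<^sub>l \<bar>\<langle>a\<^sub>k, a\<^sub>l\<rangle>\<bar>\<^sup>2\<close> over \<open>l\<close> plus \<open>\<sigma>\<^sup>2 D\<close>, so
  \<open>Y\<^sub>k\<close> has mean \<open>v\<^sub>k\<close>. When all \<open>\<bar>\<langle>a\<^sub>k, a\<^sub>l\<rangle>\<bar>\<^sup>2\<close> with \<open>k \<noteq> l\<close> are at most
  \<open>D\<^sup>2 / (8 c\<^sub>\<gamma> K)\<close>, the mean \<open>v\<^sub>k\<close> of a support index exceeds the average of all \<open>v\<^sub>l\<close>
  by \<open>3 \<gamma>\<^sub>m\<^sub>i\<^sub>n D\<^sup>2 / 4\<close>, and it suffices that neither the \<open>Y\<^sub>k\<close> of the support nor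
  the average of all \<open>Y\<^sub>l\<close> deviates by more than \<open>\<gamma>\<^sub>m\<^sub>i\<^sub>n D\<^sup>2 / 4\<close> in the harmful direction.
  These are only \<open>K + 1 \<le> D + 1\<close> Chernoff bounds, which is why \<open>N\<close> does not enter the condition
  on \<open>M\<close>. The coherence bound is a cap estimate on the sphere, obtained by replacing the
  uniform law by a normalised Gaussian vector.
\<close>

section \<open>Complex Gaussian moments\<close>

text \<open>Completing the square turns the integrand into a multiple of the normal density with
  mean b/(2a) and variance 1/(2a), whose total mass is one.\<close>

lemma nn_integral_exp_quadratic:
  fixes a b :: real
  assumes "a > 0"
  shows "(\<integral>\<^sup>+x. ennreal (exp (b * x - a * x\<^sup>2)) \<partial>lborel) = ennreal (sqrt (pi / a) * exp (b\<^sup>2 / (4 * a)))"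
proof -
  define \<mu> s where "\<mu> = b / (2 * a)" and "s = 1 / sqrt (2 * a)"
  have s: "s > 0" "s\<^sup>2 = 1 / (2 * a)"
    using assms by (auto simp: s_def power_divide)
  have eq: "exp (b * x - a * x\<^sup>2) = sqrt (pi / a) * exp (b\<^sup>2 / (4 * a)) * normal_density \<mu> s x" for x
  proof -
    have "b * x - a * x\<^sup>2 = b\<^sup>2 / (4 * a) + - (x - \<mu>)\<^sup>2 / (2 * s\<^sup>2)"
    proof -
      have "b * x - a * x\<^sup>2 = b\<^sup>2 / (4 * a) - a * (x - \<mu>)\<^sup>2"
        using assms by (simp add: \<mu>_def power2_eq_square field_simps)
      moreover have "(x - \<mu>)\<^sup>2 / (2 * s\<^sup>2) = a * (x - \<mu>)\<^sup>2"
        using assms by (simp add: s)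
      ultimately show ?thesis
        by simp
    qed
    moreover have "sqrt (2 * pi * s\<^sup>2) = sqrt (pi / a)"
      using assms by (simp add: s)
    ultimately show ?thesis
      using assms by (simp add: normal_density_def mult_exp_exp)
  qed
  interpret prob_space "density lborel (normal_density \<mu> s)"
    by (rule prob_space_normal_density) (rule s)
  have "(\<integral>\<^sup>+x. ennreal (normal_density \<mu> s x) \<partial>lborel) = 1"
    using emeasure_space_1 by (simp add: emeasure_density)
  then show ?thesis
    using assms by (simp add: eq ennreal_mult'' nn_integral_cmult)
qed

text \<open>The integrand factors over the real and imaginary axes, which leaves two real Gaussian
  integrals.\<close>

lemma nn_integral_cexp_quadratic:
  fixes w :: complex and s :: real
  assumes "s > 0"
  shows "(\<integral>\<^sup>+z. ennreal (exp (Re (w * z) - s * (cmod z)\<^sup>2)) \<partial>lborel)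
    = ennreal (pi / s * exp ((cmod w)\<^sup>2 / (4 * s)))"
proof -
  define f where "f b x = ennreal (exp ((if b = 1 then Re w else - Im w) * x - s * x\<^sup>2))"
    for b :: complex and x
  have "ennreal (exp (Re (w * z) - s * (cmod z)\<^sup>2)) = (\<Prod>b\<in>Basis. f b (z \<bullet> b))" for z
    by (simp add: Basis_complex_def f_def inner_complex_def cmod_power2 algebra_simps
        flip: ennreal_mult'' exp_add)
  then have "(\<integral>\<^sup>+z. ennreal (exp (Re (w * z) - s * (cmod z)\<^sup>2)) \<partial>lborel)
    = (\<integral>\<^sup>+z. (\<Prod>b\<in>Basis. f b (z \<bullet> b)) \<partial>lborel)" by simp
  also have "\<dots> = (\<Prod>b\<in>Basis. \<integral>\<^sup>+x. f b x \<partial>lborel)"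
    by (rule nn_integral_lborel_prod) (auto simp: f_def)
  also have "\<dots> = ennreal (sqrt (pi / s) * exp ((Re w)\<^sup>2 / (4 * s))) * ennreal (sqrt (pi / s) * exp ((Im w)\<^sup>2 / (4 * s)))"
    using assms by (simp add: Basis_complex_def f_def nn_integral_exp_quadratic del: mult_minus_left)
  also have "\<dots> = ennreal ((sqrt (pi / s) * sqrt (pi / s)) * exp ((cmod w)\<^sup>2 / (4 * s)))"
    by (simp only: cmod_power2 add_divide_distrib exp_add mult_ac flip: ennreal_mult'')
      (use assms in \<open>simp add: mult_ac flip: ennreal_mult''\<close>)
  finally show ?thesis using assms by simp
qed

lemma sets_std_cnormal [simp, measurable_cong]: "sets std_cnormal = sets borel"
  by (simp add: std_cnormal_def)

lemma space_std_cnormal [simp]: "space std_cnormal = UNIV"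
  by (simp add: std_cnormal_def)

lemma sets_cnormal [simp, measurable_cong]: "sets (cnormal v) = sets borel"
  by (simp add: cnormal_def)

lemma space_cnormal [simp]: "space (cnormal v) = UNIV"
  by (simp add: cnormal_def)

text \<open>The density contributes another -|z|^2 to the exponent. One formula then covers the
  total mass (w = 0, s = 0), the Laplace transform (s = 0) and the exponential moments of |z|^2 (w =
  0, s negative).\<close>

lemma nn_integral_std_cnormal_exp:
  assumes "s > -1"
  shows "(\<integral>\<^sup>+z. ennreal (exp (Re (w * z) - s * (cmod z)\<^sup>2)) \<partial>std_cnormal)
    = ennreal (exp ((cmod w)\<^sup>2 / (4 * (1 + s))) / (1 + s))"
proof -
  have eq: "ennreal (exp (- (cmod z)\<^sup>2) / pi) * ennreal (exp (Re (w * z) - s * (cmod z)\<^sup>2))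
    = ennreal (1 / pi) * ennreal (exp (Re (w * z) - (1 + s) * (cmod z)\<^sup>2))" for z
    by (simp add: algebra_simps flip: ennreal_mult'' exp_add)
  have "(\<integral>\<^sup>+z. ennreal (exp (Re (w * z) - s * (cmod z)\<^sup>2)) \<partial>std_cnormal)
    = ennreal (1 / pi) * (\<integral>\<^sup>+z. ennreal (exp (Re (w * z) - (1 + s) * (cmod z)\<^sup>2)) \<partial>lborel)"
    unfolding std_cnormal_def
    by (subst nn_integral_density) (auto simp: eq nn_integral_cmult simp del: times_complex.simps)
  also have "\<dots> = ennreal (1 / pi) * ennreal (pi / (1 + s) * exp ((cmod w)\<^sup>2 / (4 * (1 + s))))"
    using assms by (subst nn_integral_cexp_quadratic) auto
  also have "\<dots> = ennreal (exp ((cmod w)\<^sup>2 / (4 * (1 + s))) / (1 + s))"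
    by (simp flip: ennreal_mult')
  finally show ?thesis .
qed

lemma prob_space_std_cnormal: "prob_space std_cnormal"
proof
  show "emeasure std_cnormal (space std_cnormal) = 1"
    using nn_integral_std_cnormal_exp[of 0 0] by simp
qed

lemma prob_space_cnormal: "prob_space (cnormal v)"
  unfolding cnormal_def by (rule prob_space.prob_space_distr[OF prob_space_std_cnormal]) measurable

text \<open>As \<open>cnormal v\<close> is an image of the standard law, v = 0 is the point mass at
  0 and is included; this covers data with \<sigma> = 0.\<close>

lemma nn_integral_cnormal_exp:
  assumes "v \<ge> 0"
  shows "(\<integral>\<^sup>+z. ennreal (exp (Re (w * z))) \<partial>cnormal v) = ennreal (exp (v * (cmod w)\<^sup>2 / 4))"
proof -
  have "(\<integral>\<^sup>+z. ennreal (exp (Re (w * z))) \<partial>cnormal v)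
    = (\<integral>\<^sup>+z. ennreal (exp (Re ((w * complex_of_real (sqrt v)) * z) - 0 * (cmod z)\<^sup>2)) \<partial>std_cnormal)"
    unfolding cnormal_def by (subst nn_integral_distr) (auto simp: mult_ac)
  also have "\<dots> = ennreal (exp (v * (cmod w)\<^sup>2 / 4))"
    using assms by (subst nn_integral_std_cnormal_exp) (auto simp: norm_mult power_mult_distrib mult_ac)
  finally show ?thesis .
qed

lemma nn_integral_std_cnormal_exp_abs:
  assumes "0 \<le> t" "t < 1"
  shows "(\<integral>\<^sup>+z. ennreal (exp (t * (cmod z)\<^sup>2)) \<partial>std_cnormal) = ennreal (1 / (1 - t))"
  using nn_integral_std_cnormal_exp[of "-t" 0] assms by simp

text \<open>Hubbard--Stratonovich linearisation.\<close>

lemma exp_cmod_square_eq_nn_integral: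
  assumes "l \<ge> 0"
  shows "ennreal (exp (l * (cmod x)\<^sup>2)) =
    (\<integral>\<^sup>+g. ennreal (exp (Re (complex_of_real (2 * sqrt l) * g * x))) \<partial>std_cnormal)"
  using nn_integral_std_cnormal_exp[of 0 "complex_of_real (2 * sqrt l) * x"] assms
  by (simp add: norm_mult power_mult_distrib mult_ac)

section \<open>Noise forms and their exponential moments\<close>

lemma product_sigma_finite_const: "prob_space M \<Longrightarrow> product_sigma_finite (\<lambda>_. M)"
  by (simp add: product_sigma_finite_def prob_space_imp_sigma_finite)

lemma nn_integral_PiM_cnormal_exp:
  assumes "finite I" "v \<ge> 0"
  shows "(\<integral>\<^sup>+x. ennreal (exp (\<Sum>i\<in>I. Re (w i * x i))) \<partial>PiM I (\<lambda>_. cnormal v))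
    = ennreal (exp (v * (\<Sum>i\<in>I. (cmod (w i))\<^sup>2) / 4))"
proof -
  interpret product_sigma_finite "\<lambda>_. cnormal v"
    by (intro product_sigma_finite_const prob_space_cnormal)
  have "(\<integral>\<^sup>+x. ennreal (exp (\<Sum>i\<in>I. Re (w i * x i))) \<partial>PiM I (\<lambda>_. cnormal v))
    = (\<integral>\<^sup>+x. (\<Prod>i\<in>I. ennreal (exp (Re (w i * x i)))) \<partial>PiM I (\<lambda>_. cnormal v))"
    using assms by (simp only: exp_sum prod_ennreal exp_ge_zero)
  also have "\<dots> = (\<Prod>i\<in>I. \<integral>\<^sup>+x. ennreal (exp (Re (w i * x))) \<partial>cnormal v)"
    using assms by (intro product_nn_integral_prod) measurable
  also have "\<dots> = ennreal (exp (v * (\<Sum>i\<in>I. (cmod (w i))\<^sup>2) / 4))"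
    using assms by (simp only: nn_integral_cnormal_exp prod_ennreal exp_ge_zero)
      (simp add: exp_sum sum_distrib_left sum_divide_distrib)
  finally show ?thesis .
qed

lemma nn_integral_PiM_std_cnormal_exp_abs:
  assumes "finite I" "\<And>i. i \<in> I \<Longrightarrow> 0 \<le> t i \<and> t i < 1"
  shows "(\<integral>\<^sup>+x. ennreal (exp (\<Sum>i\<in>I. t i * (cmod (x i))\<^sup>2)) \<partial>PiM I (\<lambda>_. std_cnormal))
    = ennreal (\<Prod>i\<in>I. 1 / (1 - t i))"
proof -
  interpret product_sigma_finite "\<lambda>_. std_cnormal"
    by (intro product_sigma_finite_const prob_space_std_cnormal)
  have "(\<integral>\<^sup>+x. ennreal (exp (\<Sum>i\<in>I. t i * (cmod (x i))\<^sup>2)) \<partial>PiM I (\<lambda>_. std_cnormal))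
    = (\<integral>\<^sup>+x. (\<Prod>i\<in>I. ennreal (exp (t i * (cmod (x i))\<^sup>2))) \<partial>PiM I (\<lambda>_. std_cnormal))"
    using assms by (simp only: exp_sum prod_ennreal exp_ge_zero)
  also have "\<dots> = (\<Prod>i\<in>I. \<integral>\<^sup>+x. ennreal (exp (t i * (cmod x)\<^sup>2)) \<partial>std_cnormal)"
    using assms by (intro product_nn_integral_prod) measurable
  also have "\<dots> = (\<Prod>i\<in>I. ennreal (1 / (1 - t i)))"
    using assms by (intro prod.cong refl nn_integral_std_cnormal_exp_abs) auto
  also have "\<dots> = ennreal (\<Prod>i\<in>I. 1 / (1 - t i))"
    using assms by (intro prod_ennreal) (simp add: less_imp_le)
  finally show ?thesis .
qed

lemma exp_sum_cmod_square_eq_nn_integral: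
  assumes "finite I" "\<And>i. i \<in> I \<Longrightarrow> l i \<ge> 0"
  shows "ennreal (exp (\<Sum>i\<in>I. l i * (cmod (x i))\<^sup>2)) =
    (\<integral>\<^sup>+g. ennreal (exp (\<Sum>i\<in>I. Re (complex_of_real (2 * sqrt (l i)) * g i * x i))) \<partial>PiM I (\<lambda>_. std_cnormal))"
proof -
  interpret product_sigma_finite "\<lambda>_. std_cnormal"
    by (intro product_sigma_finite_const prob_space_std_cnormal)
  have "ennreal (exp (\<Sum>i\<in>I. l i * (cmod (x i))\<^sup>2)) = (\<Prod>i\<in>I. ennreal (exp (l i * (cmod (x i))\<^sup>2)))"
    using assms by (simp only: exp_sum prod_ennreal exp_ge_zero)
  also have "\<dots> = (\<Prod>i\<in>I. \<integral>\<^sup>+g. ennreal (exp (Re (complex_of_real (2 * sqrt (l i)) * g * x i))) \<partial>std_cnormal)"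
    using assms by (intro prod.cong refl exp_cmod_square_eq_nn_integral) auto
  also have "\<dots> = (\<integral>\<^sup>+g. (\<Prod>i\<in>I. ennreal (exp (Re (complex_of_real (2 * sqrt (l i)) * g i * x i)))) \<partial>PiM I (\<lambda>_. std_cnormal))"
    using assms by (intro product_nn_integral_prod[symmetric]) measurable
  also have "\<dots> = (\<integral>\<^sup>+g. ennreal (exp (\<Sum>i\<in>I. Re (complex_of_real (2 * sqrt (l i)) * g i * x i))) \<partial>PiM I (\<lambda>_. std_cnormal))"
    using assms by (simp only: exp_sum prod_ennreal exp_ge_zero)
  finally show ?thesis .
qed

text \<open>The law of (H, Z) on its own: fixing the columns amounts to taking a section of a
  product measure.\<close>

definition noise_law :: "nat \<Rightarrow> nat \<Rightarrow> nat \<Rightarrow> real \<Rightarrow> ((nat \<times> nat \<Rightarrow> complex) \<times> (nat \<times> nat \<Rightarrow> complex)) measure" where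
  "noise_law D N M \<sigma> = PiM ({..<N} \<times> {..<M}) (\<lambda>_. cnormal 1) \<Otimes>\<^sub>M PiM ({..<D} \<times> {..<M}) (\<lambda>_. cnormal (\<sigma>\<^sup>2))"

lemma prob_space_noise_law: "prob_space (noise_law D N M \<sigma>)"
  unfolding noise_law_def
  by (intro prob_space_pair prob_space_PiM prob_space_cnormal)

text \<open>For \<open>u l = \<langle>a\<^sub>k, a\<^sub>l\<rangle> sqrt (\<gamma> l)\<close> and \<open>b = cnj a\<^sub>k\<close> this is \<open>\<langle>a\<^sub>k, y\<^sub>m\<rangle>\<close>, so \<open>Y\<^sub>k\<close> is an average of squared moduli.\<close>

definition noise_form :: "nat \<Rightarrow> nat \<Rightarrow> (nat \<Rightarrow> complex) \<Rightarrow> (nat \<Rightarrow> complex)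
    \<Rightarrow> (nat \<times> nat \<Rightarrow> complex) \<times> (nat \<times> nat \<Rightarrow> complex) \<Rightarrow> nat \<Rightarrow> complex" where
  "noise_form D N u b \<omega> m = (\<Sum>l<N. u l * fst \<omega> (l, m)) + (\<Sum>i<D. b i * snd \<omega> (i, m))"

lemma measurable_PiM_const_component:
  assumes "i \<in> I" "sets M = sets borel"
  shows "(\<lambda>x. x i) \<in> borel_measurable (PiM I (\<lambda>_. M))"
proof -
  have "(\<lambda>x. x i) \<in> measurable (PiM I (\<lambda>_. M)) M"
    using assms by measurable
  then show ?thesis
    using measurable_cong_sets[OF refl assms(2)] by auto
qed

lemma measurable_noise_form [measurable]:
  assumes "m < M"
  shows "(\<lambda>\<omega>. noise_form D N u b \<omega> m) \<in> borel_measurable (noise_law D N M \<sigma>)"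
proof -
  have 1: "(\<lambda>\<omega>. fst \<omega> (l, m)) \<in> borel_measurable (noise_law D N M \<sigma>)" if "l < N" for l
    unfolding noise_law_def
    by (rule measurable_compose[OF measurable_fst measurable_PiM_const_component]) (use that assms in auto)
  have 2: "(\<lambda>\<omega>. snd \<omega> (i, m)) \<in> borel_measurable (noise_law D N M \<sigma>)" if "i < D" for i
    unfolding noise_law_def
    by (rule measurable_compose[OF measurable_snd measurable_PiM_const_component]) (use that assms in auto)
  show ?thesis
    unfolding noise_form_def
    by (intro borel_measurable_add borel_measurable_sum borel_measurable_times 1 2) auto
qed

text \<open>The exponent is linear in the independent entries of H and Z, and each entry has a
  coefficient of the form c_m u_l or c_m b_i. The sum of squared coefficients therefore splits into
  a column factor and the common variance.\<close>

lemma nn_integral_noise_form_exp_linear: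
  "(\<integral>\<^sup>+\<omega>. ennreal (exp (\<Sum>m<M. Re (c m * noise_form D N u b \<omega> m))) \<partial>noise_law D N M \<sigma>)
    = ennreal (exp ((\<Sum>m<M. (cmod (c m))\<^sup>2) * ((\<Sum>l<N. (cmod (u l))\<^sup>2) + \<sigma>\<^sup>2 * (\<Sum>i<D. (cmod (b i))\<^sup>2)) / 4))"
proof -
  let ?H = "PiM ({..<N} \<times> {..<M}) (\<lambda>_. cnormal 1)" and ?Z = "PiM ({..<D} \<times> {..<M}) (\<lambda>_. cnormal (\<sigma>\<^sup>2))"
  let ?h = "\<lambda>H. \<Sum>p\<in>{..<N}\<times>{..<M}. Re (c (snd p) * u (fst p) * H p)"
  let ?z = "\<lambda>Z. \<Sum>p\<in>{..<D}\<times>{..<M}. Re (c (snd p) * b (fst p) * Z p)"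
  interpret Z: prob_space ?Z by (intro prob_space_PiM prob_space_cnormal)
  have swap: "(\<Sum>m<M. \<Sum>l<n. f l m) = (\<Sum>p\<in>{..<n}\<times>{..<M}. f (fst p) (snd p))" for n and f :: "nat \<Rightarrow> nat \<Rightarrow> real"
    by (subst sum.swap) (simp add: sum.cartesian_product split_def)
  have split: "(\<Sum>m<M. Re (c m * noise_form D N u b \<omega> m)) = ?h (fst \<omega>) + ?z (snd \<omega>)" for \<omega>
  proof -
    have "(\<Sum>m<M. Re (c m * noise_form D N u b \<omega> m))
      = (\<Sum>m<M. \<Sum>l<N. Re (c m * u l * fst \<omega> (l, m))) + (\<Sum>m<M. \<Sum>i<D. Re (c m * b i * snd \<omega> (i, m)))"
      by (simp only: noise_form_def distrib_left sum_distrib_left plus_complex.sel Re_sum sum.distrib mult.assoc)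
    then show ?thesis by (simp only: swap prod.collapse)
  qed
  have sq: "(\<Sum>p\<in>{..<n}\<times>{..<M}. (cmod (c (snd p) * w (fst p)))\<^sup>2) = (\<Sum>m<M. (cmod (c m))\<^sup>2) * (\<Sum>l<n. (cmod (w l))\<^sup>2)"
    for n and w :: "nat \<Rightarrow> complex"
    unfolding swap[of "\<lambda>l m. (cmod (c m * w l))\<^sup>2" n, symmetric]
    by (simp add: norm_mult power_mult_distrib sum_product)
  have m[measurable]: "?h \<in> borel_measurable ?H" "?z \<in> borel_measurable ?Z"
    by (auto intro!: borel_measurable_sum borel_measurable_Re borel_measurable_times measurable_PiM_const_component)
  have "(\<integral>\<^sup>+\<omega>. ennreal (exp (\<Sum>m<M. Re (c m * noise_form D N u b \<omega> m))) \<partial>noise_law D N M \<sigma>)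
    = (\<integral>\<^sup>+\<omega>. ennreal (exp (?h (fst \<omega>))) * ennreal (exp (?z (snd \<omega>))) \<partial>(?H \<Otimes>\<^sub>M ?Z))"
    unfolding noise_law_def split by (simp only: exp_add ennreal_mult'' exp_ge_zero)
  also have "\<dots> = (\<integral>\<^sup>+H. \<integral>\<^sup>+Z. ennreal (exp (?h H)) * ennreal (exp (?z Z)) \<partial>?Z \<partial>?H)"
    by (subst Z.nn_integral_fst[symmetric]) (simp_all only: fst_conv snd_conv, measurable)
  also have "\<dots> = (\<integral>\<^sup>+H. ennreal (exp (?h H)) \<partial>?H) * (\<integral>\<^sup>+Z. ennreal (exp (?z Z)) \<partial>?Z)"
    by (subst nn_integral_cmult, measurable) (subst nn_integral_multc, measurable)
  also have "\<dots> = ennreal (exp (1 * ((\<Sum>m<M. (cmod (c m))\<^sup>2) * (\<Sum>l<N. (cmod (u l))\<^sup>2)) / 4))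
      * ennreal (exp (\<sigma>\<^sup>2 * ((\<Sum>m<M. (cmod (c m))\<^sup>2) * (\<Sum>i<D. (cmod (b i))\<^sup>2)) / 4))"
    by (subst (1 2) nn_integral_PiM_cnormal_exp) (simp_all only: sq finite_cartesian_product finite_lessThan zero_le_power2 zero_le_one)
  finally show ?thesis
    by (simp add: algebra_simps add_divide_distrib flip: ennreal_mult'' exp_add)
qed

text \<open>Each noise form is CN(0, v) distributed, and the forms for different columns are independent.\<close>

lemma nn_integral_noise_form_exp_square:
  fixes v \<sigma> :: real and u b :: "nat \<Rightarrow> complex" and D N :: nat
  defines "v \<equiv> (\<Sum>l<N. (cmod (u l))\<^sup>2) + \<sigma>\<^sup>2 * (\<Sum>i<D. (cmod (b i))\<^sup>2)"
  assumes t: "\<And>m. m < M \<Longrightarrow> 0 \<le> t m \<and> t m * v < 1"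
  shows "(\<integral>\<^sup>+\<omega>. ennreal (exp (\<Sum>m<M. t m * (cmod (noise_form D N u b \<omega> m))\<^sup>2)) \<partial>noise_law D N M \<sigma>)
    = ennreal (\<Prod>m<M. 1 / (1 - t m * v))"
proof -
  let ?G = "PiM {..<M} (\<lambda>_. std_cnormal)"
  let ?c = "\<lambda>g m. complex_of_real (2 * sqrt (t m)) * g m"
  have v: "v \<ge> 0" by (auto simp: v_def intro!: add_nonneg_nonneg sum_nonneg mult_nonneg_nonneg)
  interpret G: prob_space ?G by (intro prob_space_PiM prob_space_std_cnormal)
  interpret Q: prob_space "noise_law D N M \<sigma>" by (rule prob_space_noise_law)
  interpret P: pair_sigma_finite "noise_law D N M \<sigma>" ?G
    by standard
  have "(\<integral>\<^sup>+\<omega>. ennreal (exp (\<Sum>m<M. t m * (cmod (noise_form D N u b \<omega> m))\<^sup>2)) \<partial>noise_law D N M \<sigma>)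
    = (\<integral>\<^sup>+\<omega>. \<integral>\<^sup>+g. ennreal (exp (\<Sum>m<M. Re (?c g m * noise_form D N u b \<omega> m))) \<partial>?G \<partial>noise_law D N M \<sigma>)"
    using t by (subst exp_sum_cmod_square_eq_nn_integral) auto
  \<comment> \<open>Once the squares are linearised by auxiliary Gaussians g, the noise can be
    integrated first. This returns a quadratic exponent in g with independent coordinates, so the
    product over m appears.\<close>
  also have "\<dots> = (\<integral>\<^sup>+g. \<integral>\<^sup>+\<omega>. ennreal (exp (\<Sum>m<M. Re (?c g m * noise_form D N u b \<omega> m))) \<partial>noise_law D N M \<sigma> \<partial>?G)"
  proof (rule P.Fubini'[symmetric])
    have 1: "(\<lambda>x. snd x m) \<in> borel_measurable (noise_law D N M \<sigma> \<Otimes>\<^sub>M ?G)" if "m < M" for m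
      by (rule measurable_compose[OF measurable_snd measurable_PiM_const_component]) (use that in auto)
    have 2: "(\<lambda>x. noise_form D N u b (fst x) m) \<in> borel_measurable (noise_law D N M \<sigma> \<Otimes>\<^sub>M ?G)" if "m < M" for m
      by (rule measurable_compose[OF measurable_fst measurable_noise_form[OF that]])
    show "(\<lambda>(\<omega>, g). ennreal (exp (\<Sum>m<M. Re (?c g m * noise_form D N u b \<omega> m))))
        \<in> borel_measurable (noise_law D N M \<sigma> \<Otimes>\<^sub>M ?G)"
      unfolding split_def
      by (intro measurable_compose[OF _ measurable_ennreal] borel_measurable_exp borel_measurable_sum
          borel_measurable_Re borel_measurable_times 1 2) auto
  qed
  also have "\<dots> = (\<integral>\<^sup>+g. ennreal (exp (\<Sum>m<M. t m * v * (cmod (g m))\<^sup>2)) \<partial>?G)"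
  proof (rule nn_integral_cong)
    fix g
    have "(\<Sum>m<M. (cmod (?c g m))\<^sup>2) * v / 4 = (\<Sum>m<M. t m * v * (cmod (g m))\<^sup>2)"
      using t by (auto simp: sum_distrib_left sum_distrib_right sum_divide_distrib norm_mult power_mult_distrib mult_ac intro!: sum.cong)
    then show "(\<integral>\<^sup>+\<omega>. ennreal (exp (\<Sum>m<M. Re (?c g m * noise_form D N u b \<omega> m))) \<partial>noise_law D N M \<sigma>)
      = ennreal (exp (\<Sum>m<M. t m * v * (cmod (g m))\<^sup>2))"
      by (simp only: nn_integral_noise_form_exp_linear flip: v_def)
  qed
  also have "\<dots> = ennreal (\<Prod>m<M. 1 / (1 - t m * v))"
    using t v by (intro nn_integral_PiM_std_cnormal_exp_abs) auto
  finally show ?thesis .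
qed

section \<open>Exponential moments of the centred noise energy\<close>

definition noise_energy :: "nat \<Rightarrow> nat \<Rightarrow> nat \<Rightarrow> (nat \<Rightarrow> complex) \<Rightarrow> (nat \<Rightarrow> complex)
    \<Rightarrow> (nat \<times> nat \<Rightarrow> complex) \<times> (nat \<times> nat \<Rightarrow> complex) \<Rightarrow> real" where
  "noise_energy D N M u b \<omega> = (\<Sum>m<M. (cmod (noise_form D N u b \<omega> m))\<^sup>2)"

lemma measurable_noise_energy [measurable]:
  "noise_energy D N M u b \<in> borel_measurable (noise_law D N M \<sigma>)"
  unfolding noise_energy_def[abs_def]
  by (intro borel_measurable_sum borel_measurable_power borel_measurable_norm measurable_noise_form) auto

text \<open>This is ln (1 - t) \<ge> - t - 2 t^2. The linear term is kept exact because it has to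
  cancel against the centring of the energy.\<close>

lemma inverse_one_minus_le_exp:
  assumes "0 \<le> t" "t \<le> (1/2 :: real)"
  shows "1 / (1 - t) \<le> exp (t + 2 * t\<^sup>2)"
proof -
  have "exp (- t - 2 * t\<^sup>2) \<le> exp (ln (1 - t))"
    using ln_one_minus_pos_lower_bound[of t] assms by (simp only: exp_le_cancel_iff)
  then have "exp (- (t + 2 * t\<^sup>2)) \<le> 1 - t"
    using assms by (simp add: algebra_simps)
  then have "inverse (1 - t) \<le> inverse (exp (- (t + 2 * t\<^sup>2)))"
    by (intro le_imp_inverse_le) auto
  then show ?thesis
    by (metis exp_minus inverse_eq_divide inverse_inverse_eq)
qed

text \<open>The lower tail is controlled through positive exponential moments: multiply
  \<open>(1 - exp y)^3 \<le> 0\<close> by \<open>exp (- y)\<close>.\<close>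

lemma exp_minus_le_exp_combination:
  assumes "y \<ge> (0::real)"
  shows "exp (- y) \<le> 3 - 3 * exp y + exp (2 * y)"
proof -
  define e where "e = exp y"
  have e: "e \<ge> 1" using assms by (simp add: e_def)
  have "(e - 1) ^ 3 \<ge> 0" using e by simp
  then have "1 \<le> e * (3 - 3 * e + e\<^sup>2)" by (simp add: power3_eq_cube power2_eq_square algebra_simps)
  moreover have "exp (2 * y) = e\<^sup>2" by (simp add: e_def exp_double)
  ultimately show ?thesis
    using e by (simp add: exp_minus flip: e_def) (simp add: field_simps)
qed

text \<open>The left side is the mean of 3 - 3 e^y + e^(2y) when y is t times a standard exponential
  variable. After clearing denominators the first claim reduces to t^2 (1 - 8t + 4t^2) \<ge> 0,
  which is where 1/8 comes from. Nonnegativity allows the bounds to be multiplied over the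
  columns.\<close>

lemma exp_combination_mean_le:
  assumes "0 \<le> t" "t \<le> (1/8 :: real)"
  shows "3 - 3 / (1 - t) + 1 / (1 - 2 * t) \<le> exp (- t + 2 * t\<^sup>2)"
    and "0 \<le> 3 - 3 / (1 - t) + 1 / (1 - 2 * t)"
proof -
  have pos: "(1 - t) * (1 - 2 * t) > 0" using assms by simp
  have eq: "3 - 3 / (1 - t) + 1 / (1 - 2 * t) = (1 - 4 * t + 6 * t\<^sup>2) / ((1 - t) * (1 - 2 * t))"
    using assms by (simp add: divide_simps) (simp add: algebra_simps power2_eq_square)
  have "0 \<le> t\<^sup>2 * (1 - 8 * t + 4 * t\<^sup>2)"
    using assms by (intro mult_nonneg_nonneg) (auto intro: add_nonneg_nonneg)
  then have "1 - 4 * t + 6 * t\<^sup>2 \<le> (1 - t + 2 * t\<^sup>2) * ((1 - t) * (1 - 2 * t))"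
    by (simp add: algebra_simps power2_eq_square)
  then have "3 - 3 / (1 - t) + 1 / (1 - 2 * t) \<le> 1 + (- t + 2 * t\<^sup>2)"
    unfolding eq pos_divide_le_eq[OF pos] by (simp add: algebra_simps)
  also have "\<dots> \<le> exp (- t + 2 * t\<^sup>2)" by (rule exp_ge_add_one_self)
  finally show "3 - 3 / (1 - t) + 1 / (1 - 2 * t) \<le> exp (- t + 2 * t\<^sup>2)" .
  have "0 \<le> 1 - 4 * t + 6 * t\<^sup>2" using assms by (intro add_nonneg_nonneg) auto
  then show "0 \<le> 3 - 3 / (1 - t) + 1 / (1 - 2 * t)" unfolding eq using pos by simp
qed

text \<open>Each of the M columns contributes 1 / (1 - r v) \<le> exp (r v + 2 (r v)^2), and
  subtracting the mean removes the linear term.\<close>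

lemma noise_energy_mgf_upper:
  fixes v \<sigma> :: real and u b :: "nat \<Rightarrow> complex" and D N :: nat
  defines "v \<equiv> (\<Sum>l<N. (cmod (u l))\<^sup>2) + \<sigma>\<^sup>2 * (\<Sum>i<D. (cmod (b i))\<^sup>2)"
  assumes r: "0 \<le> r" "r * v \<le> 1/8"
  shows "(\<integral>\<^sup>+\<omega>. ennreal (exp (r * (noise_energy D N M u b \<omega> - real M * v))) \<partial>noise_law D N M \<sigma>)
    \<le> ennreal (exp (2 * real M * (r * v)\<^sup>2))"
proof -
  have v: "v \<ge> 0" by (auto simp: v_def intro!: add_nonneg_nonneg sum_nonneg mult_nonneg_nonneg)
  have "(\<integral>\<^sup>+\<omega>. ennreal (exp (r * (noise_energy D N M u b \<omega> - real M * v))) \<partial>noise_law D N M \<sigma>)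
    = (\<integral>\<^sup>+\<omega>. ennreal (exp (- (real M * (r * v)))) *
        ennreal (exp (\<Sum>m<M. r * (cmod (noise_form D N u b \<omega> m))\<^sup>2)) \<partial>noise_law D N M \<sigma>)"
    by (simp add: noise_energy_def sum_distrib_left mult_exp_exp algebra_simps flip: ennreal_mult'')
  also have "\<dots> = ennreal (exp (- (real M * (r * v)))) *
      (\<integral>\<^sup>+\<omega>. ennreal (exp (\<Sum>m<M. r * (cmod (noise_form D N u b \<omega> m))\<^sup>2)) \<partial>noise_law D N M \<sigma>)"
    by (intro nn_integral_cmult) (simp flip: noise_energy_def sum_distrib_left)
  also have "(\<integral>\<^sup>+\<omega>. ennreal (exp (\<Sum>m<M. r * (cmod (noise_form D N u b \<omega> m))\<^sup>2)) \<partial>noise_law D N M \<sigma>)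
      = ennreal (\<Prod>m<M. 1 / (1 - r * v))"
    unfolding v_def by (rule nn_integral_noise_form_exp_square) (use r in \<open>auto simp: v_def\<close>)
  also have "\<dots> \<le> ennreal (\<Prod>m<M. exp (r * v + 2 * (r * v)\<^sup>2))"
    using r v by (intro ennreal_leI prod_mono conjI inverse_one_minus_le_exp) auto
  also have "(\<Prod>m<M. exp (r * v + 2 * (r * v)\<^sup>2)) = exp (real M * (r * v + 2 * (r * v)\<^sup>2))"
    by (simp add: exp_of_nat_mult)
  also have "ennreal (exp (- (real M * (r * v)))) * ennreal (exp (real M * (r * v + 2 * (r * v)\<^sup>2)))
      = ennreal (exp (2 * real M * (r * v)\<^sup>2))"
    by (simp add: mult_exp_exp algebra_simps flip: ennreal_mult'')
  finally show ?thesis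
    by (simp add: mult_left_mono)
qed

text \<open>The linearisation yields exponential moments with nonnegative coefficients only. So exp
  (- y) is majorised in every column by 3 - 3 e^y + e^(2y), and the product over the columns is
  expanded into positive exponential moments.\<close>

lemma noise_energy_mgf_lower:
  fixes v \<sigma> :: real and u b :: "nat \<Rightarrow> complex" and D N :: nat
  defines "v \<equiv> (\<Sum>l<N. (cmod (u l))\<^sup>2) + \<sigma>\<^sup>2 * (\<Sum>i<D. (cmod (b i))\<^sup>2)"
  assumes r: "0 \<le> r" "r * v \<le> 1/8"
  shows "(\<integral>\<^sup>+\<omega>. ennreal (exp (r * (real M * v - noise_energy D N M u b \<omega>))) \<partial>noise_law D N M \<sigma>)
    \<le> ennreal (exp (2 * real M * (r * v)\<^sup>2))"
proof -
  let ?Q = "noise_law D N M \<sigma>"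
  let ?x = "\<lambda>\<omega> m. (cmod (noise_form D N u b \<omega> m))\<^sup>2"
  let ?J = "{0, 1, 2 :: nat}"
  define c where "c j = (if j = 0 then 3 else if j = 1 then -3 else 1 :: real)" for j :: nat
  have v: "v \<ge> 0" by (auto simp: v_def intro!: add_nonneg_nonneg sum_nonneg mult_nonneg_nonneg)
  \<comment> \<open>The function f selects in each column which of the terms 1, e^y, e^(2y) is
    taken; the product of the \<open>c (f m)\<close> is its signed coefficient.\<close>
  define F where "F \<omega> = (\<Sum>f\<in>{..<M} \<rightarrow>\<^sub>E ?J. (\<Prod>m<M. c (f m)) * exp (\<Sum>m<M. (real (f m) * r) * ?x \<omega> m))" for \<omega>
  have F_prod: "F \<omega> = (\<Prod>m<M. \<Sum>j\<in>?J. c j * exp (real j * (r * ?x \<omega> m)))" for \<omega>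
    unfolding F_def by (subst prod_sum_PiE) (auto simp: prod.distrib exp_sum mult.assoc)
  have F_ge: "exp (- (r * noise_energy D N M u b \<omega>)) \<le> F \<omega>" for \<omega>
  proof -
    have "exp (- (r * noise_energy D N M u b \<omega>)) = (\<Prod>m<M. exp (- (r * ?x \<omega> m)))"
      by (simp add: noise_energy_def sum_distrib_left exp_sum flip: sum_negf)
    also have "\<dots> \<le> F \<omega>"
      unfolding F_prod
    proof (intro prod_mono conjI)
      fix m
      show "exp (- (r * ?x \<omega> m)) \<le> (\<Sum>j\<in>?J. c j * exp (real j * (r * ?x \<omega> m)))"
        using exp_minus_le_exp_combination[of "r * ?x \<omega> m"] r by (simp add: c_def)
    qed auto
    finally show ?thesis .
  qed
  \<comment> \<open>The coefficient -3 makes the expansion signed, so the moments are moved from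
    nonnegative to Bochner integrals. The parameters are at most 2 r, and 2 r v \<le> 1/4 keeps
    every moment finite.\<close>
  have mgf: "integrable ?Q (\<lambda>\<omega>. exp (\<Sum>m<M. (real (f m) * r) * ?x \<omega> m)) \<and>
     (\<integral>\<omega>. exp (\<Sum>m<M. (real (f m) * r) * ?x \<omega> m) \<partial>?Q) = (\<Prod>m<M. 1 / (1 - real (f m) * r * v))"
    if f: "f \<in> {..<M} \<rightarrow>\<^sub>E ?J" for f
  proof -
    have "0 \<le> real (f m) * r \<and> real (f m) * r * v < 1" if "m < M" for m
      using PiE_mem[OF f, of m] that r v by auto
    moreover from this have "0 \<le> (\<Prod>m<M. 1 / (1 - real (f m) * r * v))"
      by (intro prod_nonneg) (simp add: less_imp_le)
    moreover have "(\<lambda>\<omega>. exp (\<Sum>m<M. (real (f m) * r) * ?x \<omega> m)) \<in> borel_measurable ?Q"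
      by (intro measurable_compose[OF _ borel_measurable_exp] borel_measurable_sum borel_measurable_times
          borel_measurable_power borel_measurable_norm measurable_noise_form) auto
    ultimately show ?thesis
      using nn_integral_noise_form_exp_square[where t = "\<lambda>m. real (f m) * r" and M = M and u = u and b = b
          and \<sigma> = \<sigma> and D = D and N = N]
      by (subst nn_integral_eq_integrable[symmetric]) (auto simp: v_def)
  qed
  have F_int: "integrable ?Q F"
    unfolding F_def[abs_def] using mgf by (intro Bochner_Integration.integrable_sum integrable_mult_right) auto
  have "(\<integral>\<omega>. F \<omega> \<partial>?Q) = (\<Sum>f\<in>{..<M} \<rightarrow>\<^sub>E ?J. (\<Prod>m<M. c (f m)) * (\<Prod>m<M. 1 / (1 - real (f m) * r * v)))"
    unfolding F_def using mgf by (subst Bochner_Integration.integral_sum) (auto intro!: sum.cong)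
  \<comment> \<open>The moments are themselves products over m, so the sum over f folds back into a
    product of single-column means.\<close>
  also have "\<dots> = (\<Prod>m<M. \<Sum>j\<in>?J. c j * (1 / (1 - real j * r * v)))"
    by (subst prod_sum_PiE) (simp_all only: prod.distrib finite_lessThan finite.intros)
  also have "\<dots> = (\<Prod>m<M. 3 - 3 / (1 - r * v) + 1 / (1 - 2 * (r * v)))"
  proof (rule prod.cong[OF refl])
    show "(\<Sum>j\<in>?J. c j * (1 / (1 - real j * r * v))) = 3 - 3 / (1 - r * v) + 1 / (1 - 2 * (r * v))"
      by (simp add: c_def mult.assoc)
  qed
  also have "\<dots> \<le> (\<Prod>m<M. exp (- (r * v) + 2 * (r * v)\<^sup>2))"
    using r v exp_combination_mean_le by (intro prod_mono) auto
  also have "\<dots> = exp (real M * (- (r * v) + 2 * (r * v)\<^sup>2))"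
    by (simp only: exp_of_nat_mult prod_constant card_lessThan)
  finally have F_le: "(\<integral>\<omega>. F \<omega> \<partial>?Q) \<le> exp (real M * (- (r * v) + 2 * (r * v)\<^sup>2))" .
  have "(\<integral>\<^sup>+\<omega>. ennreal (exp (r * (real M * v - noise_energy D N M u b \<omega>))) \<partial>?Q)
    = (\<integral>\<^sup>+\<omega>. ennreal (exp (real M * (r * v))) * ennreal (exp (- (r * noise_energy D N M u b \<omega>))) \<partial>?Q)"
    by (simp add: mult_exp_exp algebra_simps flip: ennreal_mult'')
  also have "\<dots> \<le> (\<integral>\<^sup>+\<omega>. ennreal (exp (real M * (r * v))) * ennreal (F \<omega>) \<partial>?Q)"
    by (intro nn_integral_mono mult_left_mono ennreal_leI F_ge) auto
  also have "\<dots> = ennreal (exp (real M * (r * v))) * ennreal (\<integral>\<omega>. F \<omega> \<partial>?Q)"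
    using F_int order.trans[OF exp_ge_zero F_ge]
    by (subst nn_integral_cmult) (auto simp: nn_integral_eq_integral)
  also have "\<dots> \<le> ennreal (exp (real M * (r * v))) * ennreal (exp (real M * (- (r * v) + 2 * (r * v)\<^sup>2)))"
    by (intro mult_left_mono ennreal_leI F_le) auto
  also have "\<dots> = ennreal (exp (2 * real M * (r * v)\<^sup>2))"
    by (simp add: mult_exp_exp algebra_simps flip: ennreal_mult'')
  finally show ?thesis .
qed

section \<open>The uniform law on the complex sphere\<close>

abbreviation cvec_sq :: "nat \<Rightarrow> (nat \<Rightarrow> complex) \<Rightarrow> real" where
  "cvec_sq D x \<equiv> (\<Sum>i<D. (cmod (x i))\<^sup>2)"

definition cvec_inner :: "nat \<Rightarrow> (nat \<Rightarrow> complex) \<Rightarrow> (nat \<Rightarrow> complex) \<Rightarrow> complex" where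
  "cvec_inner D x y = (\<Sum>i<D. cnj (x i) * y i)"

lemma measurable_cvec_component:
  "i < D \<Longrightarrow> (\<lambda>x. x i) \<in> borel_measurable (cvec_space D)"
  unfolding cvec_space_def by (rule measurable_PiM_const_component) auto

lemma measurable_cvec_sq [measurable]: "cvec_sq D \<in> borel_measurable (cvec_space D)"
  by (intro borel_measurable_sum borel_measurable_power measurable_compose[OF _ borel_measurable_norm]
      measurable_cvec_component) auto

lemma measurable_cvec_norm [measurable]: "cvec_norm D \<in> borel_measurable (cvec_space D)"
  unfolding cvec_norm_def[abs_def] by measurable

lemma measurable_cvec_inner [measurable]: "cvec_inner D b \<in> borel_measurable (cvec_space D)"
  unfolding cvec_inner_def[abs_def]
  by (intro borel_measurable_sum borel_measurable_times measurable_cvec_component borel_measurable_const) auto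

lemma product_sigma_finite_lborel: "product_sigma_finite (\<lambda>_. lborel)"
  by standard

lemma sigma_finite_cvec_space: "sigma_finite_measure (cvec_space D)"
proof -
  interpret product_sigma_finite "\<lambda>_. lborel :: complex measure" by (rule product_sigma_finite_lborel)
  show ?thesis unfolding cvec_space_def by (rule sigma_finite) simp
qed

abbreviation cvec_scale :: "nat \<Rightarrow> real \<Rightarrow> (nat \<Rightarrow> complex) \<Rightarrow> nat \<Rightarrow> complex" where
  "cvec_scale D c x \<equiv> (\<lambda>i\<in>{..<D}. complex_of_real c * x i)"

lemma measurable_cvec_scale:
  assumes [measurable]: "f \<in> borel_measurable (cvec_space D)"
  shows "(\<lambda>x. cvec_scale D (f x) x) \<in> measurable (cvec_space D) (cvec_space D)"
proof -
  show ?thesis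
    unfolding cvec_space_def
    by (intro measurable_restrict) (use assms in \<open>auto simp: cvec_space_def[symmetric] intro!: borel_measurable_times
        measurable_cvec_component measurable_compose[OF assms] borel_measurable_of_real\<close>)
qed

section \<open>Dilations of Lebesgue measure and the Gaussian mass of cones\<close>

lemma emeasure_density_distr_const:
  assumes "T \<in> measurable M N" "A \<in> sets N"
  shows "emeasure (density (distr M N T) (\<lambda>_. k)) A = k * emeasure M (T -` A \<inter> space M)"
  using assms by (simp add: emeasure_density nn_integral_cmult emeasure_distr)

text \<open>The exponent 2 is the real dimension of the complex plane.\<close>

lemma emeasure_lborel_complex_scale:
  assumes "c > 0" "A \<in> sets (borel :: complex measure)"
  shows "emeasure lborel A = ennreal (c\<^sup>2) * emeasure lborel {z. complex_of_real c * z \<in> A}"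
proof -
  have "emeasure lborel A = emeasure (density (distr lborel borel (\<lambda>x. 0 + c *\<^sub>R x)) (\<lambda>_. ennreal (\<bar>c\<bar> ^ DIM(complex)))) A"
    using lborel_affine[of c "0 :: complex"] assms by simp
  also have "\<dots> = ennreal (c\<^sup>2) * emeasure (distr lborel borel (\<lambda>x :: complex. c *\<^sub>R x)) A"
    using assms by (simp add: emeasure_density nn_integral_cmult)
  also have "emeasure (distr lborel borel (\<lambda>x :: complex. c *\<^sub>R x)) A = emeasure lborel {z. complex_of_real c * z \<in> A}"
    using assms by (simp add: emeasure_distr vimage_def scaleR_conv_of_real)
  finally show ?thesis .
qed

text \<open>A product measure is determined by its values on boxes, and on a box the scaling acts
  coordinatewise with factor c^2.\<close>

lemma emeasure_cvec_space_scale: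
  assumes c: "c > 0" and A: "A \<in> sets (cvec_space D)"
  shows "emeasure (cvec_space D) A = ennreal (c ^ (2 * D)) * emeasure (cvec_space D) {x \<in> space (cvec_space D). cvec_scale D c x \<in> A}"
proof -
  let ?L = "cvec_space D"
  interpret product_sigma_finite "\<lambda>_. lborel :: complex measure" by (rule product_sigma_finite_lborel)
  have T: "cvec_scale D c \<in> measurable ?L ?L" by (rule measurable_cvec_scale) simp
  have "density (distr ?L ?L (cvec_scale D c)) (\<lambda>_. ennreal (c ^ (2 * D))) = PiM {..<D} (\<lambda>_. lborel)"
  proof (rule PiM_eqI)
    fix A :: "nat \<Rightarrow> complex set"
    assume A: "\<And>i. i \<in> {..<D} \<Longrightarrow> A i \<in> sets lborel"
    have A': "Pi\<^sub>E {..<D} A \<in> sets ?L"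
      unfolding cvec_space_def using A by (intro sets_PiM_I_finite) auto
    have "emeasure (density (distr ?L ?L (cvec_scale D c)) (\<lambda>_. ennreal (c ^ (2 * D)))) (Pi\<^sub>E {..<D} A)
      = ennreal (c ^ (2 * D)) * emeasure ?L (cvec_scale D c -` Pi\<^sub>E {..<D} A \<inter> space ?L)"
      by (rule emeasure_density_distr_const[OF T A'])
    also have "cvec_scale D c -` Pi\<^sub>E {..<D} A \<inter> space ?L = Pi\<^sub>E {..<D} (\<lambda>i. {z. complex_of_real c * z \<in> A i})"
      by (rule set_eqI) (simp only: vimage_eq Int_iff cvec_space_def space_PiM PiE_iff restrict_extensional
          restrict_apply' space_lborel space_borel UNIV_I mem_Collect_eq simp_thms ball_triv cong: ball_cong)
    also have "emeasure ?L \<dots> = (\<Prod>i<D. emeasure lborel {z. complex_of_real c * z \<in> A i})"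
      unfolding cvec_space_def
    proof (intro emeasure_PiM)
      fix i assume "i \<in> {..<D}"
      then have "A i \<in> sets borel" using A by simp
      moreover have "(\<lambda>z. complex_of_real c * z) \<in> borel_measurable borel" by simp
      ultimately show "{z. complex_of_real c * z \<in> A i} \<in> sets lborel"
        using measurable_sets[of "\<lambda>z. complex_of_real c * z" borel borel "A i"] by (simp add: vimage_def)
    qed simp
    also have "ennreal (c ^ (2 * D)) * (\<Prod>i<D. emeasure lborel {z. complex_of_real c * z \<in> A i})
      = (\<Prod>i<D. ennreal (c\<^sup>2) * emeasure lborel {z. complex_of_real c * z \<in> A i})"
      using c by (simp add: prod.distrib ennreal_power power_mult)
    also have "\<dots> = (\<Prod>i<D. emeasure lborel (A i))"
      using A c by (intro prod.cong refl emeasure_lborel_complex_scale[symmetric]) auto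
    finally show "emeasure (density (distr ?L ?L (cvec_scale D c)) (\<lambda>_. ennreal (c ^ (2 * D)))) (Pi\<^sub>E {..<D} A)
      = (\<Prod>i<D. emeasure lborel (A i))" .
  qed (simp_all add: cvec_space_def)
  then have "emeasure ?L A = emeasure (density (distr ?L ?L (cvec_scale D c)) (\<lambda>_. ennreal (c ^ (2 * D)))) A"
    by (simp add: cvec_space_def)
  also have "\<dots> = ennreal (c ^ (2 * D)) * emeasure ?L (cvec_scale D c -` A \<inter> space ?L)"
    by (rule emeasure_density_distr_const[OF T A])
  also have "cvec_scale D c -` A \<inter> space ?L = {x \<in> space ?L. cvec_scale D c x \<in> A}" by auto
  finally show ?thesis .
qed

lemma cvec_sq_scale: "cvec_sq D (cvec_scale D c x) = c\<^sup>2 * cvec_sq D x"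
  by (simp add: norm_mult power_mult_distrib sum_distrib_left)

lemma cvec_norm_scale: "c \<ge> 0 \<Longrightarrow> cvec_norm D (cvec_scale D c x) = c * cvec_norm D x"
  unfolding cvec_norm_def cvec_sq_scale by (simp add: real_sqrt_mult)

lemma cvec_sq_nonneg: "cvec_sq D x \<ge> 0"
  by (simp add: sum_nonneg)

lemma cvec_norm_sq: "(cvec_norm D x)\<^sup>2 = cvec_sq D x"
  by (simp add: cvec_norm_def cvec_sq_nonneg)

text \<open>Layer-cake form: with q = |x|^2 it writes the Gaussian weight as a mixture of indicators
  of balls.\<close>

lemma exp_minus_eq_nn_integral:
  "ennreal (exp (- q)) = (\<integral>\<^sup>+r. ennreal (exp (- r)) * indicator {q..} r \<partial>lborel)" for q :: real
proof -
  have "((\<lambda>x :: real. - exp (- x)) \<longlongrightarrow> 0) at_top" by real_asymp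
  then have "(\<integral>\<^sup>+r. ennreal (exp (- r)) * indicator {q..} r \<partial>lborel) = ennreal (0 - (- exp (- q)))"
    by (intro nn_integral_FTC_atLeast) (auto intro!: derivative_eq_intros)
  then show ?thesis by simp
qed

text \<open>This is the Gamma function at D + 1. The powers r^D are the volume factors of complex
  balls of squared radius r.\<close>

definition radial_const :: "nat \<Rightarrow> ennreal" where
  "radial_const D = (\<integral>\<^sup>+r. ennreal (exp (- r)) * (ennreal (r ^ D) * indicator {0<..} r) \<partial>lborel)"

text \<open>The layer-cake formula and Fubini reduce the Gaussian mass to volumes of the cone inside
  balls. Each of these is a dilate of the part in the unit ball, so the radial integral separates.
  This links Gaussian directions with directions drawn from the ball.\<close>

lemma nn_integral_cone_gaussian:
  assumes C: "C \<in> sets (cvec_space D)"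
    and cone: "\<And>x c. x \<in> space (cvec_space D) \<Longrightarrow> c > 0 \<Longrightarrow> cvec_scale D c x \<in> C \<longleftrightarrow> x \<in> C"
  shows "(\<integral>\<^sup>+x. ennreal (exp (- cvec_sq D x)) * indicator C x \<partial>cvec_space D)
    = radial_const D * emeasure (cvec_space D) (C \<inter> {x \<in> space (cvec_space D). cvec_norm D x \<le> 1})"
proof -
  let ?L = "cvec_space D"
  let ?B = "\<lambda>r. {x \<in> space ?L. x \<in> C \<and> cvec_sq D x \<le> r}"
  interpret L: sigma_finite_measure ?L by (rule sigma_finite_cvec_space)
  interpret P: pair_sigma_finite lborel ?L by standard
  have [measurable]: "C \<in> sets ?L" by (rule C)
  have B[measurable]: "?B r \<in> sets ?L" for r by measurable
  have "(\<integral>\<^sup>+x. ennreal (exp (- cvec_sq D x)) * indicator C x \<partial>?L)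
    = (\<integral>\<^sup>+x. (\<integral>\<^sup>+r. ennreal (exp (- r)) * indicator {cvec_sq D x..} r * indicator C x \<partial>lborel) \<partial>?L)"
    by (subst exp_minus_eq_nn_integral) (simp add: nn_integral_multc)
  also have "\<dots> = (\<integral>\<^sup>+x. (\<integral>\<^sup>+r. ennreal (exp (- r)) * indicator {p \<in> space (lborel \<Otimes>\<^sub>M ?L). snd p \<in> C \<and> cvec_sq D (snd p) \<le> fst p} (r, x) \<partial>lborel) \<partial>?L)"
    by (intro nn_integral_cong) (auto simp: indicator_def space_pair_measure)
  also have "\<dots> = (\<integral>\<^sup>+r. (\<integral>\<^sup>+x. ennreal (exp (- r)) * indicator {p \<in> space (lborel \<Otimes>\<^sub>M ?L). snd p \<in> C \<and> cvec_sq D (snd p) \<le> fst p} (r, x) \<partial>?L) \<partial>lborel)"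
  proof (rule P.Fubini')
    have 1: "(\<lambda>p. cvec_sq D (snd p)) \<in> borel_measurable (lborel \<Otimes>\<^sub>M ?L)"
      by (rule measurable_compose[OF measurable_snd measurable_cvec_sq])
    have 2: "{p \<in> space (lborel \<Otimes>\<^sub>M ?L). snd p \<in> C \<and> cvec_sq D (snd p) \<le> fst p} \<in> sets (lborel \<Otimes>\<^sub>M ?L)"
      using 1 by measurable
    show "(\<lambda>(r, x). ennreal (exp (- r)) * indicator {p \<in> space (lborel \<Otimes>\<^sub>M ?L). snd p \<in> C \<and> cvec_sq D (snd p) \<le> fst p} (r, x))
       \<in> borel_measurable (lborel \<Otimes>\<^sub>M ?L)"
      using 2 unfolding split_def prod.collapse by measurable
  qed
  also have "\<dots> = (\<integral>\<^sup>+r. ennreal (exp (- r)) * emeasure ?L (?B r) \<partial>lborel)"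
  proof (rule nn_integral_cong)
    fix r :: real
    have "(\<integral>\<^sup>+x. ennreal (exp (- r)) * indicator {p \<in> space (lborel \<Otimes>\<^sub>M ?L). snd p \<in> C \<and> cvec_sq D (snd p) \<le> fst p} (r, x) \<partial>?L)
      = (\<integral>\<^sup>+x. ennreal (exp (- r)) * indicator (?B r) x \<partial>?L)"
      by (intro nn_integral_cong) (auto simp: indicator_def space_pair_measure)
    also have "\<dots> = ennreal (exp (- r)) * emeasure ?L (?B r)"
      by (subst nn_integral_cmult) auto
    finally show "(\<integral>\<^sup>+x. ennreal (exp (- r)) * indicator {p \<in> space (lborel \<Otimes>\<^sub>M ?L). snd p \<in> C \<and> cvec_sq D (snd p) \<le> fst p} (r, x) \<partial>?L)
      = ennreal (exp (- r)) * emeasure ?L (?B r)" .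
  qed
  also have "\<dots> = (\<integral>\<^sup>+r. ennreal (exp (- r)) * (ennreal (r ^ D) * indicator {0<..} r) * emeasure ?L (?B 1) \<partial>lborel)"
  proof (rule nn_integral_cong_AE)
    \<comment> \<open>For r > 0 the sublevel set is a dilate by \<open>sqrt r\<close>, for r < 0 it
      is empty; the single value r = 0 is discarded.\<close>
    have "AE r :: real in lborel. r \<noteq> 0" by (rule AE_lborel_singleton)
    then show "AE r in lborel. ennreal (exp (- r)) * emeasure ?L (?B r) =
        ennreal (exp (- r)) * (ennreal (r ^ D) * indicator {0<..} r) * emeasure ?L (?B 1)"
    proof (eventually_elim)
      fix r :: real assume "r \<noteq> 0"
      show "ennreal (exp (- r)) * emeasure ?L (?B r) =
        ennreal (exp (- r)) * (ennreal (r ^ D) * indicator {0<..} r) * emeasure ?L (?B 1)"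
      proof (cases "r > 0")
        case True
        have "{x \<in> space ?L. cvec_scale D (sqrt r) x \<in> ?B r} = ?B 1"
        proof (intro Collect_cong conj_cong refl)
          fix x assume x: "x \<in> space ?L"
          have "cvec_scale D (sqrt r) x \<in> space ?L"
            using measurable_space[OF measurable_cvec_scale[of "\<lambda>_. sqrt r" D] x] by simp
          moreover have "cvec_sq D (cvec_scale D (sqrt r) x) \<le> r \<longleftrightarrow> cvec_sq D x \<le> 1"
            unfolding cvec_sq_scale using True by (simp add: mult_le_cancel_left1)
          ultimately show "cvec_scale D (sqrt r) x \<in> ?B r \<longleftrightarrow> x \<in> C \<and> cvec_sq D x \<le> 1"
            using cone[OF x, of "sqrt r"] True by simp
        qed
        then have "emeasure ?L (?B r) = ennreal (sqrt r ^ (2 * D)) * emeasure ?L (?B 1)"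
          using emeasure_cvec_space_scale[of "sqrt r" "?B r" D] True by simp
        then show ?thesis
          using True by (simp add: power_mult mult.assoc)
      next
        case False
        then have "\<not> cvec_sq D x \<le> r" for x
          using cvec_sq_nonneg[of x D] \<open>r \<noteq> 0\<close> by simp
        then show ?thesis using False by simp
      qed
    qed
  qed
  also have "\<dots> = radial_const D * emeasure ?L (?B 1)"
    unfolding radial_const_def by (rule nn_integral_multc) measurable
  also have "?B 1 = C \<inter> {x \<in> space ?L. cvec_norm D x \<le> 1}"
    by (auto simp: cvec_norm_def)
  finally show ?thesis .
qed

lemma nn_integral_cvec_exp:
  assumes "s > 0"
  shows "(\<integral>\<^sup>+x. ennreal (exp (Re (\<Sum>i<D. w i * x i) - s * cvec_sq D x)) \<partial>cvec_space D)
    = ennreal ((pi / s) ^ D * exp (cvec_sq D w / (4 * s)))"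
proof -
  interpret product_sigma_finite "\<lambda>_. lborel :: complex measure" by (rule product_sigma_finite_lborel)
  have "(\<integral>\<^sup>+x. ennreal (exp (Re (\<Sum>i<D. w i * x i) - s * cvec_sq D x)) \<partial>cvec_space D)
    = (\<integral>\<^sup>+x. (\<Prod>i<D. ennreal (exp (Re (w i * x i) - s * (cmod (x i))\<^sup>2))) \<partial>PiM {..<D} (\<lambda>_. lborel))"
    by (simp only: cvec_space_def Re_sum sum_distrib_left exp_sum finite_lessThan prod_ennreal exp_ge_zero flip: sum_subtractf)
  also have "\<dots> = (\<Prod>i<D. \<integral>\<^sup>+x. ennreal (exp (Re (w i * x) - s * (cmod x)\<^sup>2)) \<partial>lborel)"
    by (intro product_nn_integral_prod) measurable
  also have "\<dots> = (\<Prod>i<D. ennreal (pi / s * exp ((cmod (w i))\<^sup>2 / (4 * s))))"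
    using assms by (intro prod.cong refl nn_integral_cexp_quadratic)
  also have "\<dots> = ennreal (\<Prod>i<D. pi / s * exp ((cmod (w i))\<^sup>2 / (4 * s)))"
    using assms by (intro prod_ennreal) auto
  also have "(\<Prod>i<D. pi / s * exp ((cmod (w i))\<^sup>2 / (4 * s))) = (pi / s) ^ D * exp (cvec_sq D w / (4 * s))"
    by (simp only: prod.distrib prod_constant card_lessThan exp_sum finite_lessThan sum_divide_distrib)
  finally show ?thesis .
qed

text \<open>The whole space is a cone, and its Gaussian mass is \<pi>^D.\<close>

lemma radial_const_ball:
  "radial_const D * emeasure (cvec_space D) {x \<in> space (cvec_space D). cvec_norm D x \<le> 1} = ennreal (pi ^ D)"
proof -
  let ?L = "cvec_space D"
  have "radial_const D * emeasure ?L (space ?L \<inter> {x \<in> space ?L. cvec_norm D x \<le> 1})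
    = (\<integral>\<^sup>+x. ennreal (exp (- cvec_sq D x)) * indicator (space ?L) x \<partial>?L)"
  proof (rule nn_integral_cone_gaussian[symmetric])
    fix x and c :: real assume x: "x \<in> space ?L"
    have "cvec_scale D c x \<in> space ?L"
      using measurable_space[OF measurable_cvec_scale[of "\<lambda>_. c" D] x] by simp
    then show "cvec_scale D c x \<in> space ?L \<longleftrightarrow> x \<in> space ?L" using x by simp
  qed simp
  also have "\<dots> = ennreal (pi ^ D)"
    using nn_integral_cvec_exp[of 1 D "\<lambda>_. 0"] by (simp cong: nn_integral_cong)
  finally show ?thesis by (simp add: Int_absorb1 Collect_restrict)
qed

text \<open>The product of the two quantities is \<pi>^D, neither 0 nor infinite, so the same holds
  for each factor.\<close>

lemma ball_measure_finite_pos: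
  "emeasure (cvec_space D) {x \<in> space (cvec_space D). cvec_norm D x \<le> 1} \<noteq> 0"
  "emeasure (cvec_space D) {x \<in> space (cvec_space D). cvec_norm D x \<le> 1} \<noteq> \<infinity>"
  "radial_const D \<noteq> 0" "radial_const D \<noteq> \<infinity>"
  using radial_const_ball[of D] zero_less_power[OF pi_gt_zero, of D]
  by (auto simp: ennreal_mult_top ennreal_top_mult ennreal_eq_0_iff simp flip: not_le split: if_splits)

section \<open>Uniform laws on the ball and the sphere\<close>

lemma prob_space_unif_cball: "prob_space (unif_cball D)"
  unfolding unif_cball_def by (intro prob_space_uniform_measure ball_measure_finite_pos)

lemma sets_unif_cball [measurable_cong, simp]: "sets (unif_cball D) = sets (cvec_space D)"
  by (simp add: unif_cball_def)

lemma sets_unif_csphere [measurable_cong, simp]: "sets (unif_csphere D r) = sets (cvec_space D)"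
  by (simp add: unif_csphere_def)

lemma space_unif_csphere [simp]: "space (unif_csphere D r) = space (cvec_space D)"
  by (simp add: unif_csphere_def)

lemma measurable_cvec_normalize:
  "(\<lambda>x. cvec_scale D (r / cvec_norm D x) x) \<in> measurable (cvec_space D) (cvec_space D)"
  by (rule measurable_cvec_scale) measurable

lemma prob_space_unif_csphere: "prob_space (unif_csphere D r)"
  unfolding unif_csphere_def
  by (rule prob_space.prob_space_distr[OF prob_space_unif_cball])
    (simp only: measurable_cvec_normalize measurable_cong_sets[OF sets_unif_cball refl])

text \<open>The radial projection of the ball and of a Gaussian vector have the same law.\<close>

lemma emeasure_unif_csphere:
  assumes E: "E \<in> sets (cvec_space D)"
  shows "emeasure (unif_csphere D r) E = (\<integral>\<^sup>+x. ennreal (exp (- cvec_sq D x)) *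
      indicator {x \<in> space (cvec_space D). cvec_scale D (r / cvec_norm D x) x \<in> E} x \<partial>cvec_space D) / ennreal (pi ^ D)"
proof -
  let ?L = "cvec_space D"
  let ?B = "{x \<in> space ?L. cvec_norm D x \<le> 1}"
  let ?C = "{x \<in> space ?L. cvec_scale D (r / cvec_norm D x) x \<in> E}"
  note measurable_cvec_normalize[measurable]
  have C: "?C \<in> sets ?L" using E by measurable
  have m: "(\<lambda>x. cvec_scale D (r / cvec_norm D x) x) \<in> measurable (unif_cball D) ?L"
    by (simp only: measurable_cvec_normalize measurable_cong_sets[OF sets_unif_cball refl])
  have "emeasure (unif_csphere D r) E = emeasure (unif_cball D) ?C"
    unfolding unif_csphere_def emeasure_distr[OF m E]
    by (rule arg_cong2[where f = emeasure]) (auto simp: unif_cball_def)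
  also have "\<dots> = emeasure ?L (?B \<inter> ?C) / emeasure ?L ?B"
    unfolding unif_cball_def using C by (intro emeasure_uniform_measure) auto
  \<comment> \<open>Expanding the fraction by the radial constant turns numerator and denominator
    into Gaussian masses of cones.\<close>
  also have "\<dots> = (radial_const D * emeasure ?L (?C \<inter> ?B)) / (radial_const D * emeasure ?L ?B)"
    using divide_mult_eq[OF ball_measure_finite_pos(3,4), of "emeasure ?L (?C \<inter> ?B)" D "emeasure ?L ?B"]
    by (simp only: Int_commute[of ?B ?C] mult.commute[of "radial_const D"])
  also have "radial_const D * emeasure ?L (?C \<inter> ?B) = (\<integral>\<^sup>+x. ennreal (exp (- cvec_sq D x)) * indicator ?C x \<partial>?L)"
  proof (rule nn_integral_cone_gaussian[symmetric, OF C])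
    fix x and c :: real assume x: "x \<in> space ?L" and c: "c > 0"
    have "cvec_scale D c x \<in> space ?L"
      using measurable_space[OF measurable_cvec_scale[of "\<lambda>_. c" D] x] by simp
    \<comment> \<open>Normalisation ignores positive factors, so the preimage \<open>?C\<close> is a
      cone.\<close>
    moreover have "cvec_scale D (r / cvec_norm D (cvec_scale D c x)) (cvec_scale D c x) = cvec_scale D (r / cvec_norm D x) x"
      using c by (subst cvec_norm_scale) (auto simp: restrict_def)
    ultimately show "cvec_scale D c x \<in> ?C \<longleftrightarrow> x \<in> ?C" using x by simp
  qed
  finally show ?thesis by (simp only: radial_const_ball)
qed

text \<open>The projection can miss the sphere only at the origin, where division by zero yields the
  zero vector. A single point is a null set as soon as D \<ge> 1.\<close>

lemma AE_unif_csphere_norm: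
  assumes "D \<ge> 1"
  shows "AE a in unif_csphere D r. cvec_sq D a = r\<^sup>2"
proof (rule AE_I')
  let ?L = "cvec_space D"
  let ?E = "{a \<in> space ?L. cvec_sq D a \<noteq> r\<^sup>2}"
  let ?C = "{x \<in> space ?L. cvec_scale D (r / cvec_norm D x) x \<in> ?E}"
  interpret product_sigma_finite "\<lambda>_. lborel :: complex measure" by (rule product_sigma_finite_lborel)
  have E: "?E \<in> sets ?L" by measurable
  have "?C \<subseteq> Pi\<^sub>E {..<D} (\<lambda>_. {0})"
  proof
    fix x assume x: "x \<in> ?C"
    have "cvec_norm D x = 0"
    proof (rule ccontr)
      assume "cvec_norm D x \<noteq> 0"
      moreover have "cvec_sq D (cvec_scale D (r / cvec_norm D x) x) \<noteq> r\<^sup>2" using x by blast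
      ultimately show False
        unfolding cvec_sq_scale by (simp add: power_divide flip: cvec_norm_sq)
    qed
    then have "cvec_sq D x = 0" by (simp add: cvec_norm_sq[symmetric])
    then have "\<forall>i<D. x i = 0" by (subst (asm) sum_nonneg_eq_0_iff) auto
    moreover have "x \<in> extensional {..<D}" using x by (auto simp: cvec_space_def space_PiM PiE_iff)
    ultimately show "x \<in> Pi\<^sub>E {..<D} (\<lambda>_. {0})" unfolding PiE_iff by auto
  qed
  moreover have "Pi\<^sub>E {..<D} (\<lambda>_. {0}) \<in> null_sets ?L"
  proof (rule null_setsI)
    show "Pi\<^sub>E {..<D} (\<lambda>_. {0}) \<in> sets ?L"
      unfolding cvec_space_def by (intro sets_PiM_I_finite) auto
    have "emeasure ?L (Pi\<^sub>E {..<D} (\<lambda>_. {0})) = (\<Prod>i<D. emeasure lborel {0 :: complex})"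
      unfolding cvec_space_def by (intro emeasure_PiM) auto
    then show "emeasure ?L (Pi\<^sub>E {..<D} (\<lambda>_. {0})) = 0" using assms by (simp add: power_0_left)
  qed
  ultimately have "AE x in ?L. x \<notin> ?C" by (auto intro: AE_I')
  then have "(\<integral>\<^sup>+x. ennreal (exp (- cvec_sq D x)) * indicator ?C x \<partial>?L) = (\<integral>\<^sup>+x. 0 \<partial>?L)"
    by (intro nn_integral_cong_AE) (auto elim: eventually_mono)
  then have "emeasure (unif_csphere D r) ?E = 0"
    by (simp only: emeasure_unif_csphere[OF E] nn_integral_const mult_zero_left) simp
  then show "?E \<in> null_sets (unif_csphere D r)" using E by (intro null_setsI) auto
  show "{a \<in> space (unif_csphere D r). cvec_sq D a \<noteq> r\<^sup>2} \<subseteq> ?E" by auto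
qed

text \<open>The square of the inner product is linearised by an auxiliary Gaussian g; the integral
  over x is then explicit and leaves a one-dimensional moment in |g|^2.\<close>

lemma nn_integral_cvec_exp_inner_sq:
  assumes "l \<ge> 0" "s > 0" "l * cvec_sq D b < s"
  shows "(\<integral>\<^sup>+x. ennreal (exp (l * (cmod (cvec_inner D b x))\<^sup>2 - s * cvec_sq D x)) \<partial>cvec_space D)
    = ennreal ((pi / s) ^ D * (1 / (1 - l * cvec_sq D b / s)))"
proof -
  let ?L = "cvec_space D"
  interpret L: sigma_finite_measure ?L by (rule sigma_finite_cvec_space)
  interpret G: prob_space std_cnormal by (rule prob_space_std_cnormal)
  interpret P: pair_sigma_finite std_cnormal ?L by standard
  let ?f = "\<lambda>g x. ennreal (exp (Re (complex_of_real (2 * sqrt l) * g * cvec_inner D b x) - s * cvec_sq D x))"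
  have "ennreal (exp (l * (cmod (cvec_inner D b x))\<^sup>2 - s * cvec_sq D x)) = (\<integral>\<^sup>+g. ?f g x \<partial>std_cnormal)" for x
  proof -
    have "ennreal (exp (l * (cmod (cvec_inner D b x))\<^sup>2 - s * cvec_sq D x))
      = ennreal (exp (- s * cvec_sq D x)) * ennreal (exp (l * (cmod (cvec_inner D b x))\<^sup>2))"
      by (simp add: mult_exp_exp flip: ennreal_mult'')
    also have "\<dots> = (\<integral>\<^sup>+g. ennreal (exp (- s * cvec_sq D x)) *
        ennreal (exp (Re (complex_of_real (2 * sqrt l) * g * cvec_inner D b x))) \<partial>std_cnormal)"
      by (subst exp_cmod_square_eq_nn_integral[OF assms(1)], subst nn_integral_cmult) auto
    finally show ?thesis
      by (simp add: mult_exp_exp flip: ennreal_mult'')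
  qed
  then have "(\<integral>\<^sup>+x. ennreal (exp (l * (cmod (cvec_inner D b x))\<^sup>2 - s * cvec_sq D x)) \<partial>?L)
    = (\<integral>\<^sup>+x. \<integral>\<^sup>+g. ?f g x \<partial>std_cnormal \<partial>?L)" by simp
  also have "\<dots> = (\<integral>\<^sup>+g. \<integral>\<^sup>+x. ?f g x \<partial>?L \<partial>std_cnormal)"
    by (rule P.Fubini') measurable
  also have "\<dots> = (\<integral>\<^sup>+g. ennreal ((pi / s) ^ D) * ennreal (exp (l * cvec_sq D b / s * (cmod g)\<^sup>2)) \<partial>std_cnormal)"
  proof (rule nn_integral_cong)
    fix g
    let ?w = "\<lambda>i. complex_of_real (2 * sqrt l) * g * cnj (b i)"
    have "complex_of_real (2 * sqrt l) * g * cvec_inner D b x = (\<Sum>i<D. ?w i * x i)" for x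
      by (simp add: cvec_inner_def sum_distrib_left mult_ac)
    then have "(\<integral>\<^sup>+x. ?f g x \<partial>?L) = ennreal ((pi / s) ^ D * exp (cvec_sq D ?w / (4 * s)))"
      using nn_integral_cvec_exp[OF assms(2), of D ?w] by (simp only:)
    also have "cvec_sq D ?w / (4 * s) = l * cvec_sq D b / s * (cmod g)\<^sup>2"
      using assms by (simp add: norm_mult power_mult_distrib mult_ac flip: sum_distrib_left)
    finally show "(\<integral>\<^sup>+x. ?f g x \<partial>?L) = ennreal ((pi / s) ^ D) * ennreal (exp (l * cvec_sq D b / s * (cmod g)\<^sup>2))"
      by (simp add: ennreal_mult'')
  qed
  also have "\<dots> = ennreal ((pi / s) ^ D) * ennreal (1 / (1 - l * cvec_sq D b / s))"
    using assms cvec_sq_nonneg[of b D]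
    by (subst nn_integral_cmult, simp, subst nn_integral_std_cnormal_exp_abs) auto
  finally show ?thesis
    using assms by (simp flip: ennreal_mult')
qed

text \<open>In Gaussian form the cap is the event |<b, x>|^2 > \<tau> |b|^2 |x|^2, homogeneous in x.
  An exponential Markov bound that weighs the two sides against each other reduces it to an explicit
  Gaussian integral.\<close>

lemma unif_csphere_cap_le:
  assumes D: "D \<ge> 1" and \<tau>: "0 \<le> \<tau>" "\<tau> \<le> 1"
  shows "emeasure (unif_csphere D (sqrt (real D)))
      {a \<in> space (cvec_space D). (cmod (cvec_inner D b a))\<^sup>2 > \<tau> * real D * cvec_sq D b}
    \<le> ennreal (2 * exp (- \<tau> * real D / 4))"
proof (cases "cvec_sq D b = 0")
  \<comment> \<open>For b = 0 both sides of the strict inequality vanish and the cap is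
    empty.\<close>
  case True
  then have "\<forall>i<D. b i = 0" by (subst (asm) sum_nonneg_eq_0_iff) auto
  then have "cvec_inner D b a = 0" for a by (simp add: cvec_inner_def)
  then show ?thesis using True by simp
next
  case False
  then have \<beta>: "cvec_sq D b > 0" using cvec_sq_nonneg[of b D] by simp
  let ?L = "cvec_space D" and ?\<beta> = "cvec_sq D b"
  let ?E = "{a \<in> space ?L. (cmod (cvec_inner D b a))\<^sup>2 > \<tau> * real D * ?\<beta>}"
  let ?C = "{x \<in> space ?L. cvec_scale D (sqrt (real D) / cvec_norm D x) x \<in> ?E}"
  \<comment> \<open>The multiplier 1 / (2 |b|^2) costs only a factor 2 in the moment of the inner
    product, while the threshold gains \<tau> |x|^2 / 2, which raises the Gaussian rate from 1 to
    s.\<close>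
  define s where "s = 1 + \<tau> / 2"
  have s: "s \<ge> 1" using \<tau> by (simp add: s_def)
  have "ennreal (exp (- cvec_sq D x)) * indicator ?C x
      \<le> ennreal (exp (1 / (2 * ?\<beta>) * (cmod (cvec_inner D b x))\<^sup>2 - s * cvec_sq D x))" for x
  proof (cases "x \<in> ?C")
    case True
    define n where "n = cvec_norm D x"
    have n2: "n\<^sup>2 = cvec_sq D x" by (simp add: n_def cvec_norm_sq)
    have "cvec_inner D b (cvec_scale D (sqrt (real D) / n) x) = complex_of_real (sqrt (real D) / n) * cvec_inner D b x"
      by (simp add: cvec_inner_def sum_distrib_left mult_ac)
    then have ineq: "\<tau> * real D * ?\<beta> < real D / n\<^sup>2 * (cmod (cvec_inner D b x))\<^sup>2"
      using True by (simp add: norm_mult power_mult_distrib norm_divide power_divide n_def)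
    \<comment> \<open>At the origin the quotient by \<open>n\<^sup>2\<close> is 0, so the strict
      inequality rules that point out.\<close>
    have "0 \<le> \<tau> * real D * ?\<beta>" using \<tau> \<beta> by simp
    then have "n \<noteq> 0" using ineq by auto
    then have "n\<^sup>2 > 0" by simp
    then have "\<tau> * ?\<beta> * n\<^sup>2 < (cmod (cvec_inner D b x))\<^sup>2"
      using ineq D by (simp add: field_simps)
    then have "0 \<le> 1 / (2 * ?\<beta>) * (cmod (cvec_inner D b x))\<^sup>2 - \<tau> / 2 * n\<^sup>2"
      using \<beta> by (simp add: field_simps)
    then have "- cvec_sq D x \<le> 1 / (2 * ?\<beta>) * (cmod (cvec_inner D b x))\<^sup>2 - s * cvec_sq D x"
      unfolding s_def n2[symmetric] by (simp add: algebra_simps)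
    then show ?thesis using True by (simp del: times_divide_eq_left)
  qed simp
  then have "(\<integral>\<^sup>+x. ennreal (exp (- cvec_sq D x)) * indicator ?C x \<partial>?L)
    \<le> (\<integral>\<^sup>+x. ennreal (exp (1 / (2 * ?\<beta>) * (cmod (cvec_inner D b x))\<^sup>2 - s * cvec_sq D x)) \<partial>?L)"
    by (intro nn_integral_mono)
  also have "\<dots> = ennreal ((pi / s) ^ D * (1 / (1 - 1 / (2 * ?\<beta>) * ?\<beta> / s)))"
    using \<beta> s by (intro nn_integral_cvec_exp_inner_sq) auto
  also have "\<dots> \<le> ennreal (pi ^ D * (2 * exp (- \<tau> * real D / 4)))"
  proof (rule ennreal_leI)
    have two: "1 / (1 - 1 / (2 * ?\<beta>) * ?\<beta> / s) \<le> 2"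
      using \<beta> s by (simp add: field_simps)
    \<comment> \<open>Converts the gain s^(-D) into exponential decay; \<tau> \<le> 1 lets the
      quadratic term of the exponential be absorbed.\<close>
    have "exp (\<tau> / 4) \<le> s"
    proof -
      have "exp (\<tau> / 4) \<le> 1 + \<tau> / 4 + (\<tau> / 4)\<^sup>2" using \<tau> by (intro exp_bound) auto
      also have "(\<tau> / 4)\<^sup>2 \<le> \<tau> / 4"
        using \<tau> by (simp add: power2_eq_square mult_left_mono)
      finally show ?thesis by (simp add: s_def)
    qed
    then have "exp (\<tau> / 4) ^ D \<le> s ^ D" by (intro power_mono) auto
    then have "exp (\<tau> * real D / 4) \<le> s ^ D" by (simp add: mult.commute flip: exp_of_nat_mult)
    then have "inverse (s ^ D) \<le> inverse (exp (\<tau> * real D / 4))" by (intro le_imp_inverse_le) auto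
    then have "pi ^ D * inverse (s ^ D) \<le> pi ^ D * inverse (exp (\<tau> * real D / 4))"
      by (intro mult_left_mono) auto
    moreover have "(pi / s) ^ D = pi ^ D * inverse (s ^ D)"
      unfolding power_divide by (rule divide_inverse)
    moreover have "exp (- \<tau> * real D / 4) = inverse (exp (\<tau> * real D / 4))"
      by (simp flip: exp_minus)
    ultimately have "(pi / s) ^ D \<le> pi ^ D * exp (- \<tau> * real D / 4)"
      by (simp only:)
    moreover have "0 \<le> 1 / (1 - 1 / (2 * ?\<beta>) * ?\<beta> / s)" using \<beta> s by (simp add: field_simps)
    ultimately have "(pi / s) ^ D * (1 / (1 - 1 / (2 * ?\<beta>) * ?\<beta> / s)) \<le> (pi ^ D * exp (- \<tau> * real D / 4)) * 2"
      using two by (intro mult_mono) auto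
    then show "(pi / s) ^ D * (1 / (1 - 1 / (2 * ?\<beta>) * ?\<beta> / s)) \<le> pi ^ D * (2 * exp (- \<tau> * real D / 4))"
      by (simp add: mult_ac)
  qed
  finally have "(\<integral>\<^sup>+x. ennreal (exp (- cvec_sq D x)) * indicator ?C x \<partial>?L) / ennreal (pi ^ D)
    \<le> ennreal (pi ^ D * (2 * exp (- \<tau> * real D / 4))) / ennreal (pi ^ D)"
    by (rule divide_right_mono_ennreal)
  also have "\<dots> = ennreal (2 * exp (- \<tau> * real D / 4))"
    by (subst divide_ennreal) auto
  finally show ?thesis
    by (subst emeasure_unif_csphere) auto
qed

section \<open>Tail bounds for the statistics\<close>

text \<open>Markov's inequality, stated with an arbitrary majorant of the indicator.\<close>

lemma emeasure_le_nn_integral: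
  assumes "A \<in> sets M" "\<And>x. x \<in> A \<Longrightarrow> 1 \<le> f x"
  shows "emeasure M A \<le> (\<integral>\<^sup>+x. f x \<partial>M)"
proof -
  have "emeasure M A = (\<integral>\<^sup>+x. indicator A x \<partial>M)" using assms by simp
  also have "\<dots> \<le> (\<integral>\<^sup>+x. f x \<partial>M)"
    using assms by (intro nn_integral_mono) (auto simp: indicator_def)
  finally show ?thesis .
qed

text \<open>The common variance of the noise forms, which the moment lemmas spell out as
  \<open>v\<close>.\<close>

definition form_var :: "nat \<Rightarrow> nat \<Rightarrow> real \<Rightarrow> (nat \<Rightarrow> complex) \<Rightarrow> (nat \<Rightarrow> complex) \<Rightarrow> real" where
  "form_var D N \<sigma> u b = (\<Sum>l<N. (cmod (u l))\<^sup>2) + \<sigma>\<^sup>2 * (\<Sum>i<D. (cmod (b i))\<^sup>2)"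

lemma form_var_nonneg: "form_var D N \<sigma> u b \<ge> 0"
  by (auto simp: form_var_def intro!: add_nonneg_nonneg sum_nonneg mult_nonneg_nonneg)

text \<open>The value \<delta> / (4 V^2) minimises 2 M r^2 V^2 - r M \<delta> over r. Using the
  bound V instead of v lets one choice of r serve all variances at once.\<close>

lemma chernoff_exponent_le:
  fixes \<delta> V v M :: real
  assumes "0 \<le> v" "v \<le> V" "0 < V" "0 \<le> M"
  shows "2 * M * (\<delta> / (4 * V\<^sup>2) * v)\<^sup>2 - \<delta> / (4 * V\<^sup>2) * (M * \<delta>) \<le> - M * \<delta>\<^sup>2 / (8 * V\<^sup>2)"
proof -
  have "2 * M * (\<delta> / (4 * V\<^sup>2) * v)\<^sup>2 \<le> 2 * M * ((\<delta> / (4 * V\<^sup>2))\<^sup>2 * V\<^sup>2)"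
    unfolding power_mult_distrib using assms by (intro mult_left_mono power_mono) auto
  also have "\<dots> = M * \<delta>\<^sup>2 / (8 * V\<^sup>2)"
    using assms by (simp add: power2_eq_square field_simps)
  finally have "2 * M * (\<delta> / (4 * V\<^sup>2) * v)\<^sup>2 \<le> M * \<delta>\<^sup>2 / (8 * V\<^sup>2)" .
  moreover have "\<delta> / (4 * V\<^sup>2) * (M * \<delta>) = 2 * (M * \<delta>\<^sup>2 / (8 * V\<^sup>2))"
    by (simp add: power2_eq_square)
  ultimately show ?thesis by (simp only: mult_minus_left minus_divide_left[symmetric])
qed

lemma noise_energy_lower_tail:
  assumes v: "form_var D N \<sigma> u b \<le> V" and \<delta>: "0 < \<delta>" "\<delta> \<le> V / 2"
  shows "emeasure (noise_law D N M \<sigma>)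
      {\<omega> \<in> space (noise_law D N M \<sigma>). noise_energy D N M u b \<omega> \<le> real M * (form_var D N \<sigma> u b - \<delta>)}
    \<le> ennreal (exp (- real M * \<delta>\<^sup>2 / (8 * V\<^sup>2)))"
proof -
  let ?Q = "noise_law D N M \<sigma>" and ?v = "form_var D N \<sigma> u b"
  let ?S = "{\<omega> \<in> space ?Q. noise_energy D N M u b \<omega> \<le> real M * (?v - \<delta>)}"
  define r where "r = \<delta> / (4 * V\<^sup>2)"
  have V: "V > 0" using \<delta> by simp
  have r: "r > 0" using V \<delta> by (simp add: r_def)
  have "r * ?v \<le> r * V" using v r by simp
  \<comment> \<open>Here r V = \<delta> / (4 V), so \<delta> \<le> V / 2 is exactly the range in
    which the moment bound applies.\<close>
  also have "r * V \<le> 1/8" using V \<delta> by (simp add: r_def power2_eq_square field_simps)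
  finally have rv: "r * ?v \<le> 1/8" .
  have "emeasure ?Q ?S \<le> (\<integral>\<^sup>+\<omega>. ennreal (exp (- (r * (real M * \<delta>)))) *
      ennreal (exp (r * (real M * ?v - noise_energy D N M u b \<omega>))) \<partial>?Q)"
  proof (rule emeasure_le_nn_integral)
    fix \<omega> assume "\<omega> \<in> ?S"
    then have "0 \<le> r * (real M * ?v - noise_energy D N M u b \<omega> - real M * \<delta>)"
      using r by (intro mult_nonneg_nonneg) (auto simp: algebra_simps)
    then show "1 \<le> ennreal (exp (- (r * (real M * \<delta>)))) * ennreal (exp (r * (real M * ?v - noise_energy D N M u b \<omega>)))"
      by (simp add: mult_exp_exp algebra_simps flip: ennreal_mult'')
  qed measurable
  also have "\<dots> = ennreal (exp (- (r * (real M * \<delta>)))) *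
      (\<integral>\<^sup>+\<omega>. ennreal (exp (r * (real M * ?v - noise_energy D N M u b \<omega>))) \<partial>?Q)"
    by (intro nn_integral_cmult) measurable
  also have "\<dots> \<le> ennreal (exp (- (r * (real M * \<delta>)))) * ennreal (exp (2 * real M * (r * ?v)\<^sup>2))"
    using noise_energy_mgf_lower[where r = r and \<sigma> = \<sigma> and u = u and N = N and b = b and D = D and M = M] r rv
    by (intro mult_left_mono) (auto simp: form_var_def)
  also have "\<dots> = ennreal (exp (2 * real M * (r * ?v)\<^sup>2 - r * (real M * \<delta>)))"
    by (simp add: mult_exp_exp flip: ennreal_mult'')
  also have "\<dots> \<le> ennreal (exp (- real M * \<delta>\<^sup>2 / (8 * V\<^sup>2)))"
    using chernoff_exponent_le[of ?v V "real M" \<delta>] form_var_nonneg v V unfolding r_def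
    by (intro ennreal_leI) auto
  finally show ?thesis .
qed

lemma exp_mean_le:
  fixes z :: "'a \<Rightarrow> real"
  assumes "finite I" "I \<noteq> {}"
  shows "exp ((1 / real (card I)) * (\<Sum>k\<in>I. z k)) \<le> (1 / real (card I)) * (\<Sum>k\<in>I. exp (z k))"
proof -
  have "exp (\<Sum>k\<in>I. (1 / real (card I)) *\<^sub>R z k) \<le> (\<Sum>k\<in>I. (1 / real (card I)) * exp (z k))"
    using assms by (intro convex_on_sum[OF _ _ exp_convex]) auto
  then show ?thesis by (simp add: sum_distrib_left)
qed

text \<open>The energies are dependent; Jensen's inequality bounds the exponential moment
  of their mean by the mean of the individual ones, at no cost in \<open>N\<close>.\<close>

lemma noise_energy_mean_upper_tail:
  assumes N': "N' \<ge> 1" and v: "\<And>k. k < N' \<Longrightarrow> form_var D N \<sigma> (u k) (b k) \<le> V" and \<delta>: "0 < \<delta>" "\<delta> \<le> V / 2"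
  shows "emeasure (noise_law D N M \<sigma>)
      {\<omega> \<in> space (noise_law D N M \<sigma>). (1 / real N') * (\<Sum>k<N'. noise_energy D N M (u k) (b k) \<omega>)
         \<ge> real M * ((1 / real N') * (\<Sum>k<N'. form_var D N \<sigma> (u k) (b k)) + \<delta>)}
    \<le> ennreal (exp (- real M * \<delta>\<^sup>2 / (8 * V\<^sup>2)))"
proof -
  let ?Q = "noise_law D N M \<sigma>" and ?v = "\<lambda>k. form_var D N \<sigma> (u k) (b k)"
  let ?e = "\<lambda>k. noise_energy D N M (u k) (b k)"
  let ?S = "{\<omega> \<in> space ?Q. (1 / real N') * (\<Sum>k<N'. ?e k \<omega>) \<ge> real M * ((1 / real N') * (\<Sum>k<N'. ?v k) + \<delta>)}"
  \<comment> \<open>Jensen's inequality requires the same r for every index, hence the choice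
    through the common bound V.\<close>
  define r where "r = \<delta> / (4 * V\<^sup>2)"
  have V: "V > 0" using \<delta> by simp
  have r: "r > 0" using V \<delta> by (simp add: r_def)
  have rv: "r * ?v k \<le> 1/8" if "k < N'" for k
  proof -
    have "r * ?v k \<le> r * V" using v[OF that] r by simp
    also have "r * V \<le> 1/8" using V \<delta> by (simp add: r_def power2_eq_square field_simps)
    finally show ?thesis .
  qed
  have "emeasure ?Q ?S \<le> (\<integral>\<^sup>+\<omega>. ennreal (exp (- (r * (real M * \<delta>))) / real N') *
      (\<Sum>k<N'. ennreal (exp (r * (?e k \<omega> - real M * ?v k)))) \<partial>?Q)"
  proof (rule emeasure_le_nn_integral)
    fix \<omega> assume "\<omega> \<in> ?S"
    then have "0 \<le> r * ((1 / real N') * (\<Sum>k<N'. ?e k \<omega>) - real M * ((1 / real N') * (\<Sum>k<N'. ?v k) + \<delta>))"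
      using r by (intro mult_nonneg_nonneg) auto
    also have "\<dots> = (1 / real N') * (\<Sum>k<N'. r * (?e k \<omega> - real M * ?v k)) - r * (real M * \<delta>)"
      by (simp add: sum_subtractf right_diff_distrib algebra_simps flip: sum_distrib_left)
    finally have "1 \<le> exp ((1 / real N') * (\<Sum>k<N'. r * (?e k \<omega> - real M * ?v k))) * exp (- (r * (real M * \<delta>)))"
      by (simp add: mult_exp_exp)
    also have "\<dots> \<le> ((1 / real N') * (\<Sum>k<N'. exp (r * (?e k \<omega> - real M * ?v k)))) * exp (- (r * (real M * \<delta>)))"
      using exp_mean_le[of "{..<N'}" "\<lambda>k. r * (?e k \<omega> - real M * ?v k)"] N'
      by (intro mult_right_mono) (auto simp: lessThan_empty_iff)
    finally have "ennreal 1 \<le> ennreal (exp (- (r * (real M * \<delta>))) / real N' * (\<Sum>k<N'. exp (r * (?e k \<omega> - real M * ?v k))))"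
      by (intro ennreal_leI) (simp add: mult_ac)
    then show "1 \<le> ennreal (exp (- (r * (real M * \<delta>))) / real N') * (\<Sum>k<N'. ennreal (exp (r * (?e k \<omega> - real M * ?v k))))"
      by (simp add: sum_ennreal flip: ennreal_mult')
  qed measurable
  also have "\<dots> = ennreal (exp (- (r * (real M * \<delta>))) / real N') *
      (\<Sum>k<N'. \<integral>\<^sup>+\<omega>. ennreal (exp (r * (?e k \<omega> - real M * ?v k))) \<partial>?Q)"
    by (subst nn_integral_cmult, measurable) (subst nn_integral_sum, measurable)
  also have "\<dots> \<le> ennreal (exp (- (r * (real M * \<delta>))) / real N') *
      (\<Sum>k<N'. ennreal (exp (r * (real M * \<delta>) - real M * \<delta>\<^sup>2 / (8 * V\<^sup>2))))"
  proof (intro mult_left_mono sum_mono)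
    fix k assume k: "k \<in> {..<N'}"
    have "(\<integral>\<^sup>+\<omega>. ennreal (exp (r * (?e k \<omega> - real M * ?v k))) \<partial>?Q) \<le> ennreal (exp (2 * real M * (r * ?v k)\<^sup>2))"
      using noise_energy_mgf_upper[where r = r and \<sigma> = \<sigma> and u = "u k" and N = N and b = "b k" and D = D and M = M] r rv[of k] k
      by (auto simp: form_var_def)
    also have "\<dots> \<le> ennreal (exp (r * (real M * \<delta>) - real M * \<delta>\<^sup>2 / (8 * V\<^sup>2)))"
      using chernoff_exponent_le[of "?v k" V "real M" \<delta>] form_var_nonneg v[of k] V k unfolding r_def
      by (intro ennreal_leI) auto
    finally show "(\<integral>\<^sup>+\<omega>. ennreal (exp (r * (?e k \<omega> - real M * ?v k))) \<partial>?Q)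
      \<le> ennreal (exp (r * (real M * \<delta>) - real M * \<delta>\<^sup>2 / (8 * V\<^sup>2)))" .
  qed simp
  also have "\<dots> = ennreal (exp (- real M * \<delta>\<^sup>2 / (8 * V\<^sup>2)))"
    using N' by (simp add: sum_ennreal mult_exp_exp flip: ennreal_mult' ennreal_of_nat_eq_real_of_nat del: sum_constant)
      (simp add: mult_exp_exp flip: ennreal_mult')
  finally show ?thesis .
qed

text \<open>The quadratic form of a sample covariance is the average over m of |<a_k, y_m>|^2. In
  particular it is real, so \<open>Re\<close> discards nothing.\<close>

lemma Ystat_eq_noise_energy:
  "Re (Ystat D (A k) (Sigma_hat M (Ymat N \<gamma> A H Z))) = noise_energy D N M
      (\<lambda>l. cvec_inner D (A k) (A l) * complex_of_real (sqrt (\<gamma> l))) (\<lambda>i. cnj (A k i)) (H, Z) / real M"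
proof -
  let ?Y = "Ymat N \<gamma> A H Z"
  let ?\<xi> = "\<lambda>m. \<Sum>i<D. cnj (A k i) * ?Y i m"
  have form: "?\<xi> m = noise_form D N (\<lambda>l. cvec_inner D (A k) (A l) * complex_of_real (sqrt (\<gamma> l))) (\<lambda>i. cnj (A k i)) (H, Z) m" for m
  proof -
    have "?\<xi> m = (\<Sum>i<D. \<Sum>l<N. cnj (A k i) * (A l i * complex_of_real (sqrt (\<gamma> l)) * H (l, m))) + (\<Sum>i<D. cnj (A k i) * Z (i, m))"
      by (simp add: Ymat_def distrib_left sum.distrib sum_distrib_left)
    also have "(\<Sum>i<D. \<Sum>l<N. cnj (A k i) * (A l i * complex_of_real (sqrt (\<gamma> l)) * H (l, m)))
      = (\<Sum>l<N. \<Sum>i<D. cnj (A k i) * (A l i * complex_of_real (sqrt (\<gamma> l)) * H (l, m)))"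
      by (rule sum.swap)
    finally show ?thesis
      by (simp add: noise_form_def cvec_inner_def sum_distrib_left sum_distrib_right mult_ac)
  qed
  have "Ystat D (A k) (Sigma_hat M ?Y)
    = (\<Sum>i<D. \<Sum>j<D. \<Sum>m<M. (1 / of_nat M) * ((cnj (A k i) * ?Y i m) * (A k j * cnj (?Y j m))))"
    by (simp add: Ystat_def Sigma_hat_def sum_distrib_left mult_ac sum_divide_distrib)
  also have "\<dots> = (\<Sum>i<D. \<Sum>m<M. \<Sum>j<D. (1 / of_nat M) * ((cnj (A k i) * ?Y i m) * (A k j * cnj (?Y j m))))"
    by (intro sum.cong refl sum.swap)
  also have "\<dots> = (\<Sum>m<M. \<Sum>i<D. \<Sum>j<D. (1 / of_nat M) * ((cnj (A k i) * ?Y i m) * (A k j * cnj (?Y j m))))"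
    by (rule sum.swap)
  also have "\<dots> = (\<Sum>m<M. (1 / of_nat M) * (?\<xi> m * cnj (?\<xi> m)))"
    unfolding cnj_sum complex_cnj_mult complex_cnj_cnj sum_product by (simp only: sum_distrib_left)
  also have "\<dots> = (\<Sum>m<M. complex_of_real ((1 / real M) * (cmod (?\<xi> m))\<^sup>2))"
    by (intro sum.cong refl) (simp only: of_real_mult of_real_divide of_real_1 of_real_of_nat_eq complex_norm_square)
  also have "\<dots> = complex_of_real (\<Sum>m<M. (1 / real M) * (cmod (?\<xi> m))\<^sup>2)"
    by simp
  finally show ?thesis
    by (simp add: form noise_energy_def sum_divide_distrib)
qed

text \<open>The estimate for a fixed incoherent dictionary. Here g and G bound the nonzero \<gamma>
  and R is the bracket in the condition on M. The factor K + 1 counts one lower tail per support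
  index and one upper tail for the average.\<close>

lemma noise_failure_le:
  fixes g G \<tau> \<sigma> L :: real and D N M K :: nat and \<gamma> :: "nat \<Rightarrow> real" and A :: "nat \<Rightarrow> nat \<Rightarrow> complex"
  defines "S \<equiv> gamma_supp N \<gamma>" and "R \<equiv> G / g * real K + \<sigma>\<^sup>2 / g"
  assumes dims: "D \<ge> 1" "N \<ge> 1" "M \<ge> 1" "K \<ge> 1" and card: "card S = K"
    and g: "g > 0" and \<gamma>: "\<And>k. k \<in> S \<Longrightarrow> g \<le> \<gamma> k \<and> \<gamma> k \<le> G"
    and norm: "\<And>k. k < N \<Longrightarrow> cvec_sq D (A k) = real D"
    and incoherent: "\<And>k l. k < N \<Longrightarrow> l < N \<Longrightarrow> k \<noteq> l \<Longrightarrow> (cmod (cvec_inner D (A k) (A l)))\<^sup>2 \<le> \<tau> * (real D)\<^sup>2"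
    and \<tau>: "\<tau> \<ge> 0" "real K * G * \<tau> \<le> g / 8" and KN: "real K * G \<le> real N * g / 8"
    and M: "real M \<ge> 512 * R\<^sup>2 * L"
  shows "emeasure (noise_law D N M \<sigma>) {\<omega> \<in> space (noise_law D N M \<sigma>). \<not> S \<subseteq> S0_set D N M \<gamma> A (fst \<omega>) (snd \<omega>)}
    \<le> ennreal ((real K + 1) * exp (- L))"
proof -
  let ?Q = "noise_law D N M \<sigma>"
  define u where "u k l = cvec_inner D (A k) (A l) * complex_of_real (sqrt (\<gamma> l))" for k l
  define b where "b k i = cnj (A k i)" for k i
  let ?e = "\<lambda>k \<omega>. noise_energy D N M (u k) (b k) \<omega>"
  let ?v = "\<lambda>k. form_var D N \<sigma> (u k) (b k)"
  define B where "B = g * (real D)\<^sup>2"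
  define s where "s = \<sigma>\<^sup>2 * real D"
  \<comment> \<open>Signal plus noise is at most B R and the cross terms at most B / 8 \<le> B R,
    which gives the factor 2.\<close>
  define V where "V = 2 * B * R"
  define \<delta> where "\<delta> = B / 4"
  have finS: "finite S" and SN: "S \<subseteq> {..<N}" by (auto simp: S_def gamma_supp_def)
  have S0: "\<gamma> k = 0" if "k < N" "k \<notin> S" for k using that by (auto simp: S_def gamma_supp_def)
  have \<gamma>0: "\<gamma> k \<ge> 0" if "k < N" for k using \<gamma>[of k] S0[OF that] g by (cases "k \<in> S") auto
  obtain k0 where "k0 \<in> S" using card dims by fastforce
  then have gG: "g \<le> G" using \<gamma> by force
  have \<gamma>_sum: "sum \<gamma> {..<N} \<le> real K * G"
  proof -
    have "sum \<gamma> {..<N} = sum \<gamma> S" using SN S0 by (intro sum.mono_neutral_right) auto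
    also have "\<dots> \<le> (\<Sum>k\<in>S. G)" using \<gamma> by (intro sum_mono) auto
    finally show ?thesis using card by simp
  qed
  have B: "B > 0" using g dims by (simp add: B_def)
  have v_eq: "?v k = (real D)\<^sup>2 * \<gamma> k + (\<Sum>l\<in>{..<N}-{k}. (cmod (cvec_inner D (A k) (A l)))\<^sup>2 * \<gamma> l) + s" if k: "k < N" for k
  proof -
    have "cvec_inner D (A k) (A k) = complex_of_real (real D)"
    proof -
      have "cvec_inner D (A k) (A k) = (\<Sum>i<D. complex_of_real ((cmod (A k i))\<^sup>2))"
        unfolding cvec_inner_def by (intro sum.cong refl) (simp add: complex_norm_square mult.commute del: of_real_power)
      then show ?thesis using norm[OF k] by (simp only: of_real_sum[symmetric])
    qed
    then have self: "(cmod (cvec_inner D (A k) (A k)))\<^sup>2 = (real D)\<^sup>2" by simp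
    have "(\<Sum>l<N. (cmod (u k l))\<^sup>2) = (\<Sum>l<N. (cmod (cvec_inner D (A k) (A l)))\<^sup>2 * \<gamma> l)"
      using \<gamma>0 by (intro sum.cong refl) (simp add: u_def norm_mult power_mult_distrib)
    also have "\<dots> = (real D)\<^sup>2 * \<gamma> k + (\<Sum>l\<in>{..<N}-{k}. (cmod (cvec_inner D (A k) (A l)))\<^sup>2 * \<gamma> l)"
      using k by (subst sum.remove[of _ k]) (auto simp: self)
    finally show ?thesis
      using norm[OF k] by (simp add: form_var_def b_def s_def)
  qed
  have cross_nonneg: "0 \<le> (\<Sum>l\<in>{..<N}-{k}. (cmod (cvec_inner D (A k) (A l)))\<^sup>2 * \<gamma> l)" for k
    using \<gamma>0 by (intro sum_nonneg) auto
  have cross_le: "(\<Sum>l\<in>{..<N}-{k}. (cmod (cvec_inner D (A k) (A l)))\<^sup>2 * \<gamma> l) \<le> B / 8" if k: "k < N" for k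
  proof -
    have "(\<Sum>l\<in>{..<N}-{k}. (cmod (cvec_inner D (A k) (A l)))\<^sup>2 * \<gamma> l) \<le> (\<Sum>l\<in>{..<N}-{k}. \<tau> * (real D)\<^sup>2 * \<gamma> l)"
      using incoherent[OF k] \<gamma>0 by (intro sum_mono mult_right_mono) auto
    also have "\<dots> \<le> (\<Sum>l<N. \<tau> * (real D)\<^sup>2 * \<gamma> l)"
      using \<gamma>0 \<tau> by (intro sum_mono2) auto
    also have "\<dots> \<le> \<tau> * (real D)\<^sup>2 * (real K * G)"
      using \<gamma>_sum \<tau> by (simp add: mult_left_mono flip: sum_distrib_left)
    also have "\<dots> = (real K * G * \<tau>) * (real D)\<^sup>2" by simp
    also have "\<dots> \<le> g / 8 * (real D)\<^sup>2" using \<tau> by (intro mult_right_mono) auto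
    finally show ?thesis by (simp add: B_def)
  qed
  have v_lower: "B + s \<le> ?v k" if "k \<in> S" for k
  proof -
    have "(real D)\<^sup>2 * g \<le> (real D)\<^sup>2 * \<gamma> k" using \<gamma>[OF that] by (intro mult_left_mono) auto
    then show ?thesis using v_eq[of k] cross_nonneg[of k] that SN by (auto simp: B_def mult.commute)
  qed
  have v_upper: "?v k \<le> (real D)\<^sup>2 * \<gamma> k + B / 8 + s" if "k < N" for k
    using v_eq[OF that] cross_le[OF that] by simp
  \<comment> \<open>One B / 8 comes from the diagonal terms through the bound on K G against N g,
    the other from the cross terms.\<close>
  have mean_le: "(1 / real N) * (\<Sum>k<N. ?v k) \<le> B / 4 + s"
  proof -
    have "(\<Sum>k<N. ?v k) \<le> (\<Sum>k<N. (real D)\<^sup>2 * \<gamma> k + (B / 8 + s))"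
      using v_upper by (intro sum_mono) (auto simp: add.assoc)
    also have "\<dots> = (real D)\<^sup>2 * sum \<gamma> {..<N} + real N * (B / 8 + s)"
      by (simp add: sum.distrib sum_distrib_left)
    also have "\<dots> \<le> (real D)\<^sup>2 * (real N * g / 8) + real N * (B / 8 + s)"
      using order.trans[OF \<gamma>_sum KN] by (intro add_right_mono mult_left_mono) auto
    also have "\<dots> = real N * (B / 4 + s)" by (simp add: B_def algebra_simps)
    finally show ?thesis using dims by (simp add: field_simps)
  qed
  have gR: "g * R = G * real K + \<sigma>\<^sup>2" using g by (simp add: R_def field_simps)
  have "1 \<le> G / g" using g gG by simp
  then have "1 * 1 \<le> G / g * real K" using dims by (intro mult_mono) auto
  moreover have "0 \<le> \<sigma>\<^sup>2 / g" using g by simp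
  ultimately have R: "R \<ge> 1" by (simp add: R_def)
  have v_V: "?v k \<le> V" if k: "k < N" for k
  proof -
    have "\<gamma> k \<le> G" using \<gamma>[of k] S0[OF k] gG g by (cases "k \<in> S") auto
    then have "(real D)\<^sup>2 * \<gamma> k \<le> (real D)\<^sup>2 * (G * real K)"
      using gG g dims by (intro mult_left_mono) (auto intro: order.trans mult_left_mono[of 1])
    \<comment> \<open>The extra factor D brings the noise to the scale of B R, which carries
      \<sigma>^2 D^2.\<close>
    moreover have "s \<le> \<sigma>\<^sup>2 * (real D)\<^sup>2"
      unfolding s_def using dims by (intro mult_left_mono) (auto simp: power2_eq_square)
    moreover have "B / 8 \<le> B * R" using B R mult_left_mono[of 1 R B] by simp
    moreover have "B * R = (real D)\<^sup>2 * (G * real K) + \<sigma>\<^sup>2 * (real D)\<^sup>2"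
      using gR unfolding B_def by (simp add: algebra_simps) (metis (no_types) distrib_left mult.assoc mult.commute)
    ultimately show ?thesis using v_upper[OF k] by (simp add: V_def)
  qed
  have \<delta>: "0 < \<delta>" "\<delta> \<le> V / 2"
    using B R mult_left_mono[of 1 R B] by (auto simp: \<delta>_def V_def)
  have exponent: "exp (- real M * \<delta>\<^sup>2 / (8 * V\<^sup>2)) \<le> exp (- L)"
  proof -
    \<comment> \<open>With \<delta> = B / 4 and V = 2 B R the scale B cancels; this is the origin of
      512.\<close>
    have "\<delta>\<^sup>2 / (8 * V\<^sup>2) = 1 / (512 * R\<^sup>2)"
      using B R by (simp add: \<delta>_def V_def power_mult_distrib power_divide)
    moreover have "L \<le> real M * (1 / (512 * R\<^sup>2))"
      using M R by (simp add: field_simps)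
    ultimately have "L \<le> real M * (\<delta>\<^sup>2 / (8 * V\<^sup>2))" by (simp only:)
    then show ?thesis by simp
  qed
  define low where "low k = {\<omega> \<in> space ?Q. ?e k \<omega> \<le> real M * (?v k - \<delta>)}" for k
  define high where "high = {\<omega> \<in> space ?Q. (1 / real N) * (\<Sum>k<N. ?e k \<omega>) \<ge> real M * ((1 / real N) * (\<Sum>k<N. ?v k) + \<delta>)}"
  have meas: "low k \<in> sets ?Q" "high \<in> sets ?Q" for k
    unfolding low_def high_def by measurable
  have "{\<omega> \<in> space ?Q. \<not> S \<subseteq> S0_set D N M \<gamma> A (fst \<omega>) (snd \<omega>)} \<subseteq> (\<Union>k\<in>S. low k) \<union> high"
  proof
    fix \<omega> assume \<omega>: "\<omega> \<in> {\<omega> \<in> space ?Q. \<not> S \<subseteq> S0_set D N M \<gamma> A (fst \<omega>) (snd \<omega>)}"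
    show "\<omega> \<in> (\<Union>k\<in>S. low k) \<union> high"
    proof (rule ccontr)
      assume not: "\<omega> \<notin> (\<Union>k\<in>S. low k) \<union> high"
      have Y: "Re (Ystat D (A k) (Sigma_hat M (Ymat N \<gamma> A (fst \<omega>) (snd \<omega>)))) = ?e k \<omega> / real M" for k
        unfolding Ystat_eq_noise_energy u_def[abs_def] b_def[abs_def] by simp
      have "k \<in> S0_set D N M \<gamma> A (fst \<omega>) (snd \<omega>)" if k: "k \<in> S" for k
      proof -
        have "(1 / real N) * (\<Sum>l<N. ?e l \<omega>) < real M * (B / 4 + s + \<delta>)"
        proof -
          have "(1 / real N) * (\<Sum>l<N. ?e l \<omega>) < real M * ((1 / real N) * (\<Sum>k<N. ?v k) + \<delta>)"
            using not \<omega> by (auto simp: high_def not_le)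
          also have "\<dots> \<le> real M * (B / 4 + s + \<delta>)"
            using mean_le by (intro mult_left_mono) auto
          finally show ?thesis .
        qed
        \<comment> \<open>The gap closes because B / 4 + s + \<delta> = B / 2 + s, while a support
          index retains at least 3 B / 4 + s after losing \<delta>.\<close>
        also have "\<dots> \<le> real M * (?v k - \<delta>)"
          using v_lower[OF k] B by (intro mult_left_mono) (auto simp: \<delta>_def)
        also have "\<dots> < ?e k \<omega>" using not \<omega> k by (auto simp: low_def not_le)
        finally have "((1 / real N) * (\<Sum>l<N. ?e l \<omega>)) / real M < ?e k \<omega> / real M"
          using dims by (intro divide_strict_right_mono) auto
        then show ?thesis
          using k SN by (auto simp: S0_set_def Let_def Y mult.commute simp flip: sum_divide_distrib)
      qed
      then show False using \<omega> by auto
    qed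
  qed
  then have "emeasure ?Q {\<omega> \<in> space ?Q. \<not> S \<subseteq> S0_set D N M \<gamma> A (fst \<omega>) (snd \<omega>)} \<le> emeasure ?Q ((\<Union>k\<in>S. low k) \<union> high)"
    using meas finS by (intro emeasure_mono sets.Un sets.finite_UN) auto
  also have "\<dots> \<le> emeasure ?Q (\<Union>k\<in>S. low k) + emeasure ?Q high"
    using meas finS by (intro emeasure_subadditive sets.finite_UN) auto
  also have "\<dots> \<le> (\<Sum>k\<in>S. emeasure ?Q (low k)) + emeasure ?Q high"
    using meas finS by (intro add_right_mono emeasure_subadditive_finite) auto
  also have "\<dots> \<le> (\<Sum>k\<in>S. ennreal (exp (- L))) + ennreal (exp (- L))"
  proof (intro add_mono sum_mono)
    fix k assume "k \<in> S"
    then have "?v k \<le> V" using v_V SN by auto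
    then show "emeasure ?Q (low k) \<le> ennreal (exp (- L))"
      unfolding low_def using noise_energy_lower_tail \<delta> exponent by (meson ennreal_leI order.trans)
  next
    show "emeasure ?Q high \<le> ennreal (exp (- L))"
      unfolding high_def using noise_energy_mean_upper_tail[OF dims(2), of D N \<sigma> u b V \<delta> M] v_V \<delta> exponent
      by (meson ennreal_leI order.trans)
  qed
  also have "\<dots> = ennreal ((real K + 1) * exp (- L))"
    by (simp add: card distrib_right ennreal_plus ennreal_mult' flip: ennreal_of_nat_eq_real_of_nat)
  finally show ?thesis .
qed

section \<open>Coherence of the random columns\<close>

definition dictionary_law :: "nat \<Rightarrow> nat \<Rightarrow> (nat \<Rightarrow> nat \<Rightarrow> complex) measure" where
  "dictionary_law D N = PiM {..<N} (\<lambda>_. unif_csphere D (sqrt (real D)))"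

lemma data_law_eq: "data_law D N M \<sigma> = dictionary_law D N \<Otimes>\<^sub>M noise_law D N M \<sigma>"
  by (simp add: data_law_def dictionary_law_def noise_law_def)

lemma prob_space_dictionary_law: "prob_space (dictionary_law D N)"
  unfolding dictionary_law_def by (intro prob_space_PiM prob_space_unif_csphere)

lemma measurable_dictionary_entry:
  assumes "k < N" "i < D"
  shows "(\<lambda>A. A k i) \<in> borel_measurable (dictionary_law D N)"
proof -
  have 1: "(\<lambda>A. A k) \<in> measurable (dictionary_law D N) (unif_csphere D (sqrt (real D)))"
    unfolding dictionary_law_def using assms by (intro measurable_component_singleton) auto
  have 2: "(\<lambda>a. a i) \<in> borel_measurable (unif_csphere D (sqrt (real D)))"
    using measurable_cvec_component[OF assms(2)] by (simp only: measurable_cong_sets[OF sets_unif_csphere refl])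
  show ?thesis by (rule measurable_compose[OF 1 2])
qed

lemma borel_measurable_cnj: "f \<in> borel_measurable M \<Longrightarrow> (\<lambda>x. cnj (f x)) \<in> borel_measurable M"
  by (rule measurable_compose[OF _ borel_measurable_continuous_onI]) (auto intro: continuous_intros)

lemma measurable_dictionary_coherence:
  assumes "k < N" "l < N"
  shows "{A \<in> space (dictionary_law D N). (cmod (cvec_inner D (A l) (A k)))\<^sup>2 > \<tau> * cvec_sq D (A l)}
    \<in> sets (dictionary_law D N)"
proof -
  have [measurable]: "(\<lambda>A. cvec_inner D (A l) (A k)) \<in> borel_measurable (dictionary_law D N)"
    unfolding cvec_inner_def
    by (intro borel_measurable_sum borel_measurable_times borel_measurable_cnj measurable_dictionary_entry) (use assms in auto)
  have [measurable]: "(\<lambda>A. cvec_sq D (A l)) \<in> borel_measurable (dictionary_law D N)"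
    by (intro borel_measurable_sum borel_measurable_power measurable_compose[OF _ borel_measurable_norm]
        measurable_dictionary_entry) (use assms in auto)
  show ?thesis by measurable
qed

text \<open>Column k is integrated out with all the others fixed. The threshold is relative to
  |a_l|^2, so the cap bound applies to every value of a_l.\<close>

lemma dictionary_coherence_pair_le:
  assumes D: "D \<ge> 1" and \<tau>: "0 \<le> \<tau>" "\<tau> \<le> 1" and kl: "k < N" "l < N" "k \<noteq> l"
  shows "emeasure (dictionary_law D N)
      {A \<in> space (dictionary_law D N). (cmod (cvec_inner D (A l) (A k)))\<^sup>2 > \<tau> * real D * cvec_sq D (A l)}
    \<le> ennreal (2 * exp (- \<tau> * real D / 4))"
proof -
  let ?U = "unif_csphere D (sqrt (real D))" and ?P = "dictionary_law D N" and ?I = "{..<N} - {k}"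
  let ?E = "{A \<in> space ?P. (cmod (cvec_inner D (A l) (A k)))\<^sup>2 > \<tau> * real D * cvec_sq D (A l)}"
  let ?cap = "\<lambda>b. {a \<in> space (cvec_space D). (cmod (cvec_inner D b a))\<^sup>2 > \<tau> * real D * cvec_sq D b}"
  interpret product_sigma_finite "\<lambda>_. ?U"
    by (intro product_sigma_finite_const prob_space_unif_csphere)
  interpret I: prob_space "PiM ?I (\<lambda>_. ?U)" by (intro prob_space_PiM prob_space_unif_csphere)
  have ins: "{..<N} = insert k ?I" using kl by auto
  have P: "?P = PiM (insert k ?I) (\<lambda>_. ?U)" unfolding dictionary_law_def using ins by simp
  have E: "?E \<in> sets ?P" using kl by (intro measurable_dictionary_coherence)
  have "emeasure ?P ?E = (\<integral>\<^sup>+A. indicator ?E A \<partial>PiM (insert k ?I) (\<lambda>_. ?U))"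
    by (simp only: P[symmetric] nn_integral_indicator[OF E])
  also have "\<dots> = (\<integral>\<^sup>+x. \<integral>\<^sup>+y. indicator ?E (x(k := y)) \<partial>?U \<partial>PiM ?I (\<lambda>_. ?U))"
    by (intro product_nn_integral_insert) (simp_all only: P[symmetric] borel_measurable_indicator[OF E], auto)
  also have "\<dots> \<le> (\<integral>\<^sup>+x. ennreal (2 * exp (- \<tau> * real D / 4)) \<partial>PiM ?I (\<lambda>_. ?U))"
  proof (rule nn_integral_mono)
    fix x assume "x \<in> space (PiM ?I (\<lambda>_. ?U))"
    have "(\<integral>\<^sup>+y. indicator ?E (x(k := y)) \<partial>?U) \<le> (\<integral>\<^sup>+y. indicator (?cap (x l)) y \<partial>?U)"
      using kl by (intro nn_integral_mono) (auto simp: indicator_def)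
    also have "\<dots> = emeasure ?U (?cap (x l))"
      by (intro nn_integral_indicator) simp
    also have "\<dots> \<le> ennreal (2 * exp (- \<tau> * real D / 4))"
      by (rule unif_csphere_cap_le[OF D \<tau>])
    finally show "(\<integral>\<^sup>+y. indicator ?E (x(k := y)) \<partial>?U) \<le> ennreal (2 * exp (- \<tau> * real D / 4))" .
  qed
  also have "\<dots> = ennreal (2 * exp (- \<tau> * real D / 4))"
    by (simp add: I.emeasure_space_1)
  finally show ?thesis .
qed

text \<open>A union bound over ordered pairs; the exceptional event is delivered as a measurable set
  so that its indicator can be integrated.\<close>

lemma dictionary_coherence_le:
  assumes D: "D \<ge> 1" and \<tau>: "0 \<le> \<tau>" "\<tau> \<le> 1"
  shows "\<exists>E\<in>sets (dictionary_law D N).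
    emeasure (dictionary_law D N) E \<le> ennreal ((real N)\<^sup>2 * (2 * exp (- \<tau> * real D / 4))) \<and>
    (\<forall>A\<in>space (dictionary_law D N) - E. \<forall>k<N. \<forall>l<N. k \<noteq> l \<longrightarrow>
      (cmod (cvec_inner D (A l) (A k)))\<^sup>2 \<le> \<tau> * real D * cvec_sq D (A l))"
proof (intro bexI conjI ballI allI impI)
  let ?P = "dictionary_law D N"
  let ?F = "\<lambda>p. {A \<in> space ?P. (cmod (cvec_inner D (A (snd p)) (A (fst p))))\<^sup>2 > \<tau> * real D * cvec_sq D (A (snd p))}"
  let ?J = "{p \<in> {..<N} \<times> {..<N}. fst p \<noteq> snd p}"
  have F: "?F p \<in> sets ?P" if "p \<in> ?J" for p
    using that by (intro measurable_dictionary_coherence) auto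
  have fin: "finite ?J" by simp
  show "(\<Union>p\<in>?J. ?F p) \<in> sets ?P" using F fin by (intro sets.finite_UN) auto
  have "emeasure ?P (\<Union>p\<in>?J. ?F p) \<le> (\<Sum>p\<in>?J. emeasure ?P (?F p))"
    using F fin by (intro emeasure_subadditive_finite) auto
  also have "\<dots> \<le> (\<Sum>p\<in>?J. ennreal (2 * exp (- \<tau> * real D / 4)))"
    using dictionary_coherence_pair_le[OF D \<tau>] by (intro sum_mono) auto
  also have "\<dots> \<le> (\<Sum>p\<in>{..<N} \<times> {..<N}. ennreal (2 * exp (- \<tau> * real D / 4)))"
    by (intro sum_mono2) auto
  also have "\<dots> = ennreal ((real N)\<^sup>2 * (2 * exp (- \<tau> * real D / 4)))"
    by (simp add: power2_eq_square ennreal_mult' flip: ennreal_of_nat_eq_real_of_nat)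
  finally show "emeasure ?P (\<Union>p\<in>?J. ?F p) \<le> ennreal ((real N)\<^sup>2 * (2 * exp (- \<tau> * real D / 4)))" .
  show "(cmod (cvec_inner D (A l) (A k)))\<^sup>2 \<le> \<tau> * real D * cvec_sq D (A l)"
    if "A \<in> space ?P - (\<Union>p\<in>?J. ?F p)" "k < N" "l < N" "k \<noteq> l" for A and k l :: nat
  proof (rule ccontr)
    assume "\<not> ?thesis"
    then have "A \<in> ?F (k, l)" using that by simp
    moreover have "(k, l) \<in> ?J" using that by simp
    ultimately show False using that by blast
  qed
qed

lemma AE_dictionary_norm:
  assumes "D \<ge> 1"
  shows "AE A in dictionary_law D N. \<forall>k<N. cvec_sq D (A k) = real D"
proof -
  have "AE A in dictionary_law D N. \<forall>k\<in>{..<N}. cvec_sq D (A k) = (sqrt (real D))\<^sup>2"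
  proof (rule AE_finite_allI)
    fix k assume "k \<in> {..<N}"
    then show "AE A in dictionary_law D N. cvec_sq D (A k) = (sqrt (real D))\<^sup>2"
      unfolding dictionary_law_def
      by (intro AE_PiM_component[where P = "\<lambda>a. cvec_sq D a = (sqrt (real D))\<^sup>2"] prob_space_unif_csphere
          AE_unif_csphere_norm assms)
  qed simp
  then show ?thesis by (auto elim: eventually_mono)
qed

section \<open>Measurability of the failure event and integration over the dictionary\<close>

lemma measurable_Ystat:
  assumes k: "k < N"
  shows "(\<lambda>x. Re (Ystat D (fst x k) (Sigma_hat M (Ymat N \<gamma> (fst x) (fst (snd x)) (snd (snd x))))))
    \<in> borel_measurable (dictionary_law D N \<Otimes>\<^sub>M noise_law D N M \<sigma>)"
proof -
  let ?R = "dictionary_law D N \<Otimes>\<^sub>M noise_law D N M \<sigma>"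
  have A: "(\<lambda>x. fst x k i) \<in> borel_measurable ?R" if "k < N" "i < D" for k i
    by (rule measurable_compose[OF measurable_fst measurable_dictionary_entry[OF that]])
  have "(\<lambda>\<omega>. fst \<omega> (l, m)) \<in> borel_measurable (noise_law D N M \<sigma>)" if "l < N" "m < M" for l m
    unfolding noise_law_def
    by (rule measurable_compose[OF measurable_fst measurable_PiM_const_component]) (use that in auto)
  then have H: "(\<lambda>x. fst (snd x) (l, m)) \<in> borel_measurable ?R" if "l < N" "m < M" for l m
    by (rule measurable_compose[OF measurable_snd]) (use that in auto)
  have "(\<lambda>\<omega>. snd \<omega> (i, m)) \<in> borel_measurable (noise_law D N M \<sigma>)" if "i < D" "m < M" for i m
    unfolding noise_law_def
    by (rule measurable_compose[OF measurable_snd measurable_PiM_const_component]) (use that in auto)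
  then have Z: "(\<lambda>x. snd (snd x) (i, m)) \<in> borel_measurable ?R" if "i < D" "m < M" for i m
    by (rule measurable_compose[OF measurable_snd]) (use that in auto)
  have Y: "(\<lambda>x. Ymat N \<gamma> (fst x) (fst (snd x)) (snd (snd x)) i m) \<in> borel_measurable ?R" if "i < D" "m < M" for i m
    unfolding Ymat_def
    by (intro borel_measurable_add borel_measurable_sum borel_measurable_times borel_measurable_const A H Z)
      (use that in auto)
  have "(\<lambda>x. Ystat D (fst x k) (Sigma_hat M (Ymat N \<gamma> (fst x) (fst (snd x)) (snd (snd x))))) \<in> borel_measurable ?R"
    unfolding Ystat_def Sigma_hat_def
    by (intro borel_measurable_sum borel_measurable_times borel_measurable_const borel_measurable_cnj A Y)
      (use k in auto)
  then show ?thesis by measurable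
qed

lemma measurable_S0_set:
  assumes "S \<subseteq> {..<N}"
  shows "{x \<in> space (dictionary_law D N \<Otimes>\<^sub>M noise_law D N M \<sigma>). \<not> S \<subseteq> S0_set D N M \<gamma> (fst x) (fst (snd x)) (snd (snd x))}
    \<in> sets (dictionary_law D N \<Otimes>\<^sub>M noise_law D N M \<sigma>)"
proof -
  let ?R = "dictionary_law D N \<Otimes>\<^sub>M noise_law D N M \<sigma>"
  let ?Y = "\<lambda>k x. Re (Ystat D (fst x k) (Sigma_hat M (Ymat N \<gamma> (fst x) (fst (snd x)) (snd (snd x)))))"
  \<comment> \<open>Failure means that some support index lies at or below the average, a finite
    union of closed comparisons.\<close>
  have eq: "{x \<in> space ?R. \<not> S \<subseteq> S0_set D N M \<gamma> (fst x) (fst (snd x)) (snd (snd x))}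
    = (\<Union>k\<in>S. {x \<in> space ?R. ?Y k x \<le> (1 / real N) * (\<Sum>l<N. ?Y l x)})"
    using assms by (auto simp: S0_set_def Let_def not_le)
  have "{x \<in> space ?R. ?Y k x \<le> (1 / real N) * (\<Sum>l<N. ?Y l x)} \<in> sets ?R" if "k \<in> S" for k
  proof (rule borel_measurable_le)
    show "?Y k \<in> borel_measurable ?R" using that assms by (intro measurable_Ystat) auto
    show "(\<lambda>x. (1 / real N) * (\<Sum>l<N. ?Y l x)) \<in> borel_measurable ?R"
      by (intro borel_measurable_times borel_measurable_const borel_measurable_sum measurable_Ystat) auto
  qed
  then show ?thesis
    unfolding eq using finite_subset[OF assms] by (intro sets.finite_UN) auto
qed

text \<open>By Fubini the failure probability is the mean over A of the noise probability of the
  section at A. The section is bounded by 1 on the coherent event and by the noise estimate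
  elsewhere.\<close>

lemma data_law_failure_le:
  fixes g G \<tau> \<sigma> L :: real and D N M K :: nat and \<gamma> :: "nat \<Rightarrow> real"
  defines "S \<equiv> gamma_supp N \<gamma>" and "R \<equiv> G / g * real K + \<sigma>\<^sup>2 / g"
  assumes dims: "D \<ge> 1" "N \<ge> 1" "M \<ge> 1" "K \<ge> 1" and card: "card S = K"
    and g: "g > 0" and \<gamma>: "\<And>k. k \<in> S \<Longrightarrow> g \<le> \<gamma> k \<and> \<gamma> k \<le> G"
    and \<tau>: "0 \<le> \<tau>" "\<tau> \<le> 1" "real K * G * \<tau> \<le> g / 8" and KN: "real K * G \<le> real N * g / 8"
    and M: "real M \<ge> 512 * R\<^sup>2 * L"
  shows "measure (data_law D N M \<sigma>) {\<omega> \<in> space (data_law D N M \<sigma>).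
      case \<omega> of (A, H, Z) \<Rightarrow> S \<subseteq> S0_set D N M \<gamma> A H Z}
    \<ge> 1 - (real K + 1) * exp (- L) - (real N)\<^sup>2 * (2 * exp (- \<tau> * real D / 4))"
proof -
  let ?P = "dictionary_law D N" and ?Q = "noise_law D N M \<sigma>"
  let ?a = "(real N)\<^sup>2 * (2 * exp (- \<tau> * real D / 4))" and ?b = "(real K + 1) * exp (- L)"
  interpret P: prob_space ?P by (rule prob_space_dictionary_law)
  interpret Q: prob_space ?Q by (rule prob_space_noise_law)
  interpret PQ: pair_prob_space ?P ?Q ..
  let ?Bad = "{x \<in> space (?P \<Otimes>\<^sub>M ?Q). \<not> S \<subseteq> S0_set D N M \<gamma> (fst x) (fst (snd x)) (snd (snd x))}"
  have SN: "S \<subseteq> {..<N}" by (auto simp: S_def gamma_supp_def)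
  have Bad: "?Bad \<in> sets (?P \<Otimes>\<^sub>M ?Q)" by (rule measurable_S0_set[OF SN])
  from dictionary_coherence_le[OF dims(1) \<tau>(1,2), of N]
  obtain E where E: "E \<in> sets ?P" "emeasure ?P E \<le> ennreal ?a"
    and coh: "\<forall>A\<in>space ?P - E. \<forall>k<N. \<forall>l<N. k \<noteq> l \<longrightarrow>
      (cmod (cvec_inner D (A l) (A k)))\<^sup>2 \<le> \<tau> * real D * cvec_sq D (A l)"
    by blast
  have "emeasure (?P \<Otimes>\<^sub>M ?Q) ?Bad = (\<integral>\<^sup>+A. emeasure ?Q (Pair A -` ?Bad) \<partial>?P)"
    by (rule Q.emeasure_pair_measure_alt[OF Bad])
  also have "\<dots> \<le> (\<integral>\<^sup>+A. indicator E A + ennreal ?b \<partial>?P)"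
  \<comment> \<open>The column norms equal \<open>sqrt D\<close> only almost surely, so the
    comparison of the integrands is almost everywhere too.\<close>
  proof (rule nn_integral_mono_AE, use AE_dictionary_norm[OF dims(1), of N] AE_space in eventually_elim)
    fix A assume norm: "\<forall>k<N. cvec_sq D (A k) = real D" and A: "A \<in> space ?P"
    show "emeasure ?Q (Pair A -` ?Bad) \<le> indicator E A + ennreal ?b"
    proof (cases "A \<in> E")
      case True
      then show ?thesis by (simp add: Q.emeasure_le_1 add_increasing2)
    next
      case False
      have "Pair A -` ?Bad = {\<omega> \<in> space ?Q. \<not> S \<subseteq> S0_set D N M \<gamma> A (fst \<omega>) (snd \<omega>)}"
        using A by (auto simp: space_pair_measure)
      also have "emeasure ?Q \<dots> \<le> ennreal ?b"
        unfolding S_def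
      proof (rule noise_failure_le[where g = g and G = G and \<tau> = \<tau>])
        show "(cmod (cvec_inner D (A k) (A l)))\<^sup>2 \<le> \<tau> * (real D)\<^sup>2" if "k < N" "l < N" "k \<noteq> l" for k l
        proof -
          have "(cmod (cvec_inner D (A k) (A l)))\<^sup>2 \<le> \<tau> * real D * cvec_sq D (A k)"
            using coh that A False by blast
          moreover have "cvec_sq D (A k) = real D" using norm that by blast
          ultimately show ?thesis by (simp only: power2_eq_square mult.assoc)
        qed
      qed (use dims card g \<gamma> norm \<tau> KN M in \<open>auto simp: S_def R_def\<close>)
      finally show ?thesis using False by simp
    qed
  qed
  also have "\<dots> = emeasure ?P E + ennreal ?b"
    using E by (subst nn_integral_add) (auto simp: P.emeasure_space_1)
  also have "\<dots> \<le> ennreal (?a + ?b)"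
    using E by (subst ennreal_plus) (auto intro: add_right_mono)
  finally have "measure (?P \<Otimes>\<^sub>M ?Q) ?Bad \<le> ?a + ?b"
    unfolding PQ.P.emeasure_eq_measure by (subst (asm) ennreal_le_iff) auto
  moreover have "measure (?P \<Otimes>\<^sub>M ?Q) (space (?P \<Otimes>\<^sub>M ?Q) - ?Bad) = 1 - measure (?P \<Otimes>\<^sub>M ?Q) ?Bad"
    by (rule PQ.P.prob_compl[OF Bad])
  moreover have "{\<omega> \<in> space (data_law D N M \<sigma>). case \<omega> of (A, H, Z) \<Rightarrow> S \<subseteq> S0_set D N M \<gamma> A H Z}
    = space (?P \<Otimes>\<^sub>M ?Q) - ?Bad"
    unfolding data_law_eq by auto
  ultimately show ?thesis by (simp add: data_law_eq)
qed

section \<open>Choice of constants and final estimate\<close>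

lemma prob_space_data_law: "prob_space (data_law D N M \<sigma>)"
  unfolding data_law_eq by (intro prob_space_pair prob_space_dictionary_law prob_space_noise_law)

theorem theorem4:
  shows "\<exists>c0 c4 c6 c7 :: real. c0 > 0 \<and> c4 > 0 \<and> c6 > 0 \<and> c7 > 0 \<and>
    (\<forall>(\<epsilon>::real) (D::nat) (N::nat) (M::nat) (K::nat) (\<gamma>::nat \<Rightarrow> real) (\<sigma>::real).
      0 < \<epsilon> \<and> \<epsilon> < 1 \<and> D \<ge> 1 \<and> N \<ge> 1 \<and> M \<ge> 1 \<and>
      (\<forall>k<N. \<gamma> k \<ge> 0) \<and> card (gamma_supp N \<gamma>) = K \<and>
      real M \<ge> c4 * ((gamma_max N \<gamma> / gamma_min N \<gamma>) * real K + \<sigma>^2 / gamma_min N \<gamma>)^2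
                    * ln ((exp 1 * real D)^2 / \<epsilon>) \<and>
      real K \<le> min (c6 * real D / ((gamma_max N \<gamma> / gamma_min N \<gamma>) * ln (real D * real N)))
                   (c7 * real N / (gamma_max N \<gamma> / gamma_min N \<gamma>))
      \<longrightarrow> measure (data_law D N M \<sigma>)
            {\<omega> \<in> space (data_law D N M \<sigma>).
               (case \<omega> of (A, H, Z) \<Rightarrow> gamma_supp N \<gamma> \<subseteq> S0_set D N M \<gamma> A H Z)}
          \<ge> 1 - \<epsilon> - c0 / (real D * sqrt (real D)))"
proof (rule exI[of _ 2], rule exI[of _ 512], rule exI[of _ "1/256"], rule exI[of _ "1/8"], intro conjI allI impI, goal_cases)
  \<comment> \<open>The witness 2 is the prefactor of the cap bound, 512 comes from the Chernoff
    exponent, 1/256 leaves room in the coherence exponent, and 1/8 keeps the average small.\<close>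
  case (5 \<epsilon> D N M K \<gamma> \<sigma>)
  define g G where "g = gamma_min N \<gamma>" and "G = gamma_max N \<gamma>"
  let ?S = "gamma_supp N \<gamma>"
  let ?good = "measure (data_law D N M \<sigma>) {\<omega> \<in> space (data_law D N M \<sigma>).
      case \<omega> of (A, H, Z) \<Rightarrow> ?S \<subseteq> S0_set D N M \<gamma> A H Z}"
  define L where "L = ln ((exp 1 * real D)\<^sup>2 / \<epsilon>)"
  from 5 have \<epsilon>: "0 < \<epsilon>" "\<epsilon> < 1" and dims: "D \<ge> 1" "N \<ge> 1" "M \<ge> 1" and \<gamma>0: "\<And>k. k < N \<Longrightarrow> \<gamma> k \<ge> 0"
    and card: "card ?S = K" and M: "real M \<ge> 512 * (G / g * real K + \<sigma>\<^sup>2 / g)\<^sup>2 * L"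
    and KD: "real K \<le> 1/256 * real D / (G / g * ln (real D * real N))"
    and KN: "real K \<le> 1/8 * real N / (G / g)"
    by (auto simp: g_def G_def L_def)
  have finS: "finite ?S" by (simp add: gamma_supp_def)
  show ?case
  proof (cases "K = 0")
    \<comment> \<open>With empty support \<open>gamma_min\<close> and \<open>gamma_max\<close> are
      taken over an empty set and say nothing, but the inclusion is trivial and the event is the
      whole space.\<close>
    case True
    interpret prob_space "data_law D N M \<sigma>" by (rule prob_space_data_law)
    have "?S = {}" using True card finS by simp
    then have "?good = measure (data_law D N M \<sigma>) (space (data_law D N M \<sigma>))"
      by (intro arg_cong2[where f = measure]) auto
    moreover have "0 \<le> 2 / (real D * sqrt (real D))" by simp
    ultimately show ?thesis using \<epsilon> by (simp only: prob_space)
  next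
    case False
    then have ne: "?S \<noteq> {}" using card by auto
    have K: "K \<ge> 1" using False by simp
    have \<gamma>: "g \<le> \<gamma> k \<and> \<gamma> k \<le> G" if "k \<in> ?S" for k
      using finS that by (auto simp: g_def G_def gamma_min_def gamma_max_def)
    have "g \<in> \<gamma> ` ?S"
      unfolding g_def gamma_min_def using finS ne by (intro Min_in) auto
    then have g: "g > 0" using \<gamma>0 by (force simp: gamma_supp_def)
    then have gG: "g \<le> G" using ne \<gamma> by force
    define c where "c = G / g"
    have c: "c \<ge> 1" using g gG by (simp add: c_def)
    define l where "l = ln (real D * real N)"
    \<comment> \<open>If the logarithm were 0, division by zero would make the upper bound on K
      equal to 0, against K \<ge> 1. This excludes D N = 1.\<close>
    have "l \<noteq> 0" using KD K by (auto simp: l_def)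
    then have "D * N \<noteq> 1" unfolding l_def by (metis ln_one of_nat_1 of_nat_mult)
    then have "D * N \<ge> 2" using dims by (cases "D * N") auto
    then have DN: "real D * real N \<ge> 2" by (metis of_nat_le_iff of_nat_mult of_nat_numeral)
    have "1/2 \<le> ln (2 :: real)" using ln_le_minus_one[of "1/2 :: real"] by (simp add: ln_div)
    also have "\<dots> \<le> l" unfolding l_def using DN by (intro ln_mono) auto
    finally have l: "l \<ge> 1/2" .
    have Kcl: "256 * (real K * c) * l \<le> real D"
      using KD c l unfolding c_def[symmetric] l_def[symmetric] by (simp add: field_simps)
    \<comment> \<open>The largest coherence level with K G \<tau> \<le> g / 8.\<close>
    define \<tau> where "\<tau> = 1 / (8 * (real K * c))"
    have Kc: "real K * c \<ge> 1" using mult_mono[of 1 "real K" 1 c] K c by simp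
    have \<tau>: "0 \<le> \<tau>" "\<tau> \<le> 1" "real K * G * \<tau> \<le> g / 8"
      using Kc K g gG by (auto simp: \<tau>_def c_def field_simps)
    have KN': "real K * G \<le> real N * g / 8"
      using KN g gG by (simp add: field_simps)
    have main: "?good \<ge> 1 - (real K + 1) * exp (- L) - (real N)\<^sup>2 * (2 * exp (- \<tau> * real D / 4))"
      using data_law_failure_le[OF dims K card g \<gamma> \<tau> KN' M] by simp
    have KleD: "real K \<le> real D"
    proof -
      have "real K \<le> real K * c" using c by (simp add: mult_le_cancel_left1)
      also have "\<dots> \<le> 256 * (real K * c) * l" using Kc l mult_mono[of 1 "256 * l" "real K * c" "real K * c"]
        by (simp add: mult_ac)
      finally show ?thesis using Kcl by simp
    qed
    \<comment> \<open>Here exp (- L) = \<epsilon> / (e D)^2, and K \<le> D gives K + 1 \<le> 2 D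
      \<le> (e D)^2.\<close>
    have noise: "(real K + 1) * exp (- L) \<le> \<epsilon>"
    proof -
      have pos: "(exp 1 * real D)\<^sup>2 > 0" using dims by simp
      have "exp (- L) = \<epsilon> / (exp 1 * real D)\<^sup>2"
        using pos \<epsilon> by (simp add: L_def exp_minus)
      moreover have "real K + 1 \<le> (exp 1 * real D)\<^sup>2"
      proof -
        have "real K + 1 \<le> 2 * real D" using KleD dims by simp
        also have "\<dots> \<le> (2 * real D)\<^sup>2" using dims by (intro self_le_power) auto
        also have "\<dots> \<le> (exp 1 * real D)\<^sup>2"
          using exp_ge_add_one_self[of 1] by (intro power_mono mult_right_mono) auto
        finally show ?thesis .
      qed
      ultimately show ?thesis using pos \<epsilon> by (simp add: pos_divide_le_eq mult_left_mono mult.commute)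
    qed
    have sphere: "(real N)\<^sup>2 * (2 * exp (- \<tau> * real D / 4)) \<le> 2 / (real D * sqrt (real D))"
    proof -
      \<comment> \<open>Two logarithms of D N suffice: one factor N^2 pays for the union over pairs,
        and the remaining D^(-2) is below D^(-3/2).\<close>
      have "2 * l \<le> \<tau> * real D / 4"
        using Kcl Kc l by (simp add: \<tau>_def field_simps)
      then have "exp (- \<tau> * real D / 4) \<le> exp (- (2 * l))" by simp
      also have "\<dots> = 1 / (real D * real N)\<^sup>2"
        using DN by (simp add: l_def exp_minus exp_double inverse_eq_divide)
      finally have "(real N)\<^sup>2 * (2 * exp (- \<tau> * real D / 4)) \<le> (real N)\<^sup>2 * (2 * (1 / (real D * real N)\<^sup>2))"
        by (intro mult_left_mono) auto
      also have "\<dots> = 2 / (real D * real D)"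
        using dims by (simp add: power2_eq_square field_simps)
      also have "\<dots> \<le> 2 / (real D * sqrt (real D))"
        using dims by (intro divide_left_mono mult_left_mono) (auto intro: real_le_lsqrt simp: power2_eq_square)
      finally show ?thesis .
    qed
    from main noise sphere show ?thesis by linarith
  qed
qed auto

end
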